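(* Let $X$ be a bubble space consisting of a sphere $S^{n_r}$ and $r-1$ disks $D^{n_1},\ldots,D^{n_{r-1}}$, with $n_1<\cdots<n_r$, and let $f:X\to X$ be a continuous map. Let $E=\{i\mid n_i \text{ even}\}$ and $O=\{i\mid n_i\text{ odd}\}$, where $i$ ranges over $\{1,\dots,r\}$. Then $L(f^m,X)=0$ for all integers $m\ge 1$ if and only if $\{(f_{\ast n_i})\mid i\in O\}$ is a permutation of $\{1\}\cup\{(f_{\ast n_i})\mid i\in E\}$, where $(f_{\ast n_i})$ is the eigenvalue of the map induced by $f$ on $H_{n_i}(X)=\mathbb{Q}$ (homology with rational coefficients).
   Context: Bubble spaces. A bubble space is obtained recursively by gluing disks along injective maps of their boundaries. Start with a sphere $S^n$, $n\ge 2$. Glue a disk $D^{d_1}$, $1\le d_1\le n$, through an embedding $g_1:\partial D^{d_1}=S^{d_1-1}\to S^n$, i.e. take the pushout of $D^{d_1}\hookleftarrow S^{d_1-1}\to S^n$. Next, glue another disk $D^{d_2}$ (along an embedding of its boundary) either to $S^n\setminus \mathrm{Im}(g_1)$ or to the interior of the disk $D^{d_1}$, in the latter case requiring also $d_2\le d_1$. The result of repeating this process a finite number of times is called a bubble space; it consists of the sphere $S^n$ and the attached disks. Spaces are assumed to be connected simplicial complexes. In the situation of the claim, the rational homology of $X$ is $\mathbb{Q}$ in degree $0$ and in each degree $n_i$, and $0$ in all other degrees. Lefschetz number. For a continuous map $g:X\to X$, $L(g,X)=\sum_{k\ge 0}(-1)^k\operatorname{tr}\big(g_{\ast k}:H_k(X;\mathbb{Q})\to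 H_k(X;\mathbb{Q})\big)$; $f^m$ is the $m$-th iterate of $f$.
   Formalization: The two collections of eigenvalues are compared as multisets after discarding eigenvalues equal to 0; as printed the "only if" fails, e.g. S^3 with a 2-disk glued along an unknotted circle and f a retraction onto S^3 (eigenvalues 1 and 0, all L(f^m)=0). *)

theory Defs
  imports "HOL-Analysis.Analysis" "HOL-Homology.Homology"
begin

section \<open>Finite-dimensional linear algebra over the rationals\<close>

text \<open>Rational vector spaces are \<open>module\<close> records with scalars of type \<open>rat\<close>; only
  \<open>carrier\<close>, \<open>zero\<close>, \<open>add\<close> and \<open>smult\<close> are relevant.\<close>

definition finite_basis :: "(rat, 'v) module \<Rightarrow> 'v set \<Rightarrow> bool" where
  "finite_basis M B \<longleftrightarrow> finite B \<and> B \<subseteq> carrier M \<and>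
     (\<forall>x \<in> carrier M. \<exists>!a. a \<in> extensional B \<and> x = (\<Oplus>\<^bsub>M\<^esub>b\<in>B. a b \<odot>\<^bsub>M\<^esub> b))"

definition coords :: "(rat, 'v) module \<Rightarrow> 'v set \<Rightarrow> 'v \<Rightarrow> 'v \<Rightarrow> rat" where
  "coords M B x = (THE a. a \<in> extensional B \<and> x = (\<Oplus>\<^bsub>M\<^esub>b\<in>B. a b \<odot>\<^bsub>M\<^esub> b))"

text \<open>The sum of the diagonal entries of the matrix of \<open>T\<close> in some (hence any) basis;
  the value 0 in infinite dimension is a convention.\<close>

definition endo_trace :: "(rat, 'v) module \<Rightarrow> ('v \<Rightarrow> 'v) \<Rightarrow> rat" where
  "endo_trace M T =
     (if \<exists>B. finite_basis M B
      then let B = (SOME B. finite_basis M B) in \<Sum>b\<in>B. coords M B (T b) b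
      else 0)"

definition endo_eigenvalue :: "(rat, 'v) module \<Rightarrow> ('v \<Rightarrow> 'v) \<Rightarrow> rat \<Rightarrow> bool" where
  "endo_eigenvalue M T l \<longleftrightarrow> (\<exists>v \<in> carrier M. v \<noteq> \<zero>\<^bsub>M\<^esub> \<and> T v = l \<odot>\<^bsub>M\<^esub> v)"


section \<open>Singular homology with rational coefficients\<close>

text \<open>The rational counterparts of the notions of \<^theory>\<open>HOL-Homology.Simplices\<close>, which fixes
  integer coefficients; the singular simplices, their faces and their images are the ones
  defined there.\<close>

type_synonym 'a rat_chain = "((nat \<Rightarrow> real) \<Rightarrow> 'a) \<Rightarrow>\<^sub>0 rat"

definition rat_scale :: "rat \<Rightarrow> ('b \<Rightarrow>\<^sub>0 rat) \<Rightarrow> ('b \<Rightarrow>\<^sub>0 rat)" where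
  "rat_scale q c = Poly_Mapping.map ((*) q) c"

definition rat_extend :: "('b \<Rightarrow> 'c \<Rightarrow>\<^sub>0 rat) \<Rightarrow> ('b \<Rightarrow>\<^sub>0 rat) \<Rightarrow> ('c \<Rightarrow>\<^sub>0 rat)" where
  "rat_extend g c = (\<Sum>s \<in> Poly_Mapping.keys c. rat_scale (Poly_Mapping.lookup c s) (g s))"

definition rat_chains :: "nat \<Rightarrow> 'a topology \<Rightarrow> 'a rat_chain set" where
  "rat_chains p X = {c. Poly_Mapping.keys c \<subseteq> singular_simplex_set p X}"

definition rat_boundary :: "nat \<Rightarrow> 'a rat_chain \<Rightarrow> 'a rat_chain" where
  "rat_boundary p c =
     (if p = 0 then 0
      else rat_extend (\<lambda>s. \<Sum>k\<le>p. Poly_Mapping.single (singular_face p k s) ((-1) ^ k)) c)"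

definition rat_cycles :: "nat \<Rightarrow> 'a topology \<Rightarrow> 'a rat_chain set" where
  "rat_cycles p X = {c \<in> rat_chains p X. rat_boundary p c = 0}"

definition rat_boundaries :: "nat \<Rightarrow> 'a topology \<Rightarrow> 'a rat_chain set" where
  "rat_boundaries p X = rat_boundary (Suc p) ` rat_chains (Suc p) X"

text \<open>The quotient of the cycles by the boundaries, whose elements are cosets.\<close>

definition rat_homology :: "nat \<Rightarrow> 'a topology \<Rightarrow> (rat, 'a rat_chain set) module" where
  "rat_homology p X =
     \<lparr>carrier = (\<lambda>z. {z + b | b. b \<in> rat_boundaries p X}) ` rat_cycles p X,
      monoid.mult = undefined,
      one = undefined,
      zero = rat_boundaries p X,
      add = (\<lambda>C D. {c + d | c d. c \<in> C \<and> d \<in> D}),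
      smult = (\<lambda>q C. {rat_scale q c + b | c b. c \<in> C \<and> b \<in> rat_boundaries p X})\<rparr>"

definition rat_chain_map :: "nat \<Rightarrow> ('a \<Rightarrow> 'b) \<Rightarrow> 'a rat_chain \<Rightarrow> 'b rat_chain" where
  "rat_chain_map p f = rat_extend (\<lambda>s. Poly_Mapping.single (simplex_map p f s) 1)"

definition rat_hom_induced ::
    "nat \<Rightarrow> 'a topology \<Rightarrow> 'b topology \<Rightarrow> ('a \<Rightarrow> 'b) \<Rightarrow> 'a rat_chain set \<Rightarrow> 'b rat_chain set" where
  "rat_hom_induced p X Y f C = {rat_chain_map p f c + b | c b. c \<in> C \<and> b \<in> rat_boundaries p Y}"

text \<open>\<open>Sum_any\<close> is the sum over the \<open>k\<close> with nonzero summand; it stands for the sum over all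
  \<open>k \<ge> 0\<close> for spaces whose homology vanishes in all large degrees.\<close>

definition lefschetz_number :: "'a topology \<Rightarrow> ('a \<Rightarrow> 'a) \<Rightarrow> rat" where
  "lefschetz_number X f =
     Sum_any (\<lambda>k. (-1) ^ k * endo_trace (rat_homology k X) (rat_hom_induced k X X f))"

text \<open>Meaningful only if the homology in degree \<open>p\<close> is one-dimensional.\<close>

definition hom_eigenvalue :: "nat \<Rightarrow> 'a topology \<Rightarrow> ('a \<Rightarrow> 'a) \<Rightarrow> rat" where
  "hom_eigenvalue p X f =
     (THE l. endo_eigenvalue (rat_homology p X) (rat_hom_induced p X X f) l)"


section \<open>Bubble spaces\<close>

definition disk :: "nat \<Rightarrow> (nat \<Rightarrow> real) topology" where
  "disk d = subtopology (Euclidean_space d) {x. (\<Sum>i<d. x i ^ 2) \<le> 1}"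

definition disk_interior :: "nat \<Rightarrow> (nat \<Rightarrow> real) set" where
  "disk_interior d = topspace (Euclidean_space d) \<inter> {x. (\<Sum>i<d. x i ^ 2) < 1}"

text \<open>For \<open>d \<ge> 1\<close>, the boundary of \<open>disk d\<close> is \<open>nsphere (d - 1)\<close>, literally as a subspace
  of the same type.\<close>

abbreviation disk_boundary :: "nat \<Rightarrow> (nat \<Rightarrow> real) topology" where
  "disk_boundary d \<equiv> nsphere (d - 1)"

text \<open>\<open>X\<close>, with the maps \<open>i\<close> and \<open>h\<close>, is the pushout of \<open>D \<hookleftarrow> A \<rightarrow> Y\<close>, where \<open>A\<close> is a subspace
  of \<open>D\<close> and the second map is \<open>g\<close>: the points of \<open>X\<close> are those of the disjoint union of \<open>Y\<close> and
  \<open>D\<close> with each \<open>a\<close> in \<open>A\<close> identified with \<open>g a\<close> (and nothing more), and \<open>X\<close> has the quotient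
  (final) topology.\<close>

definition is_pushout ::
    "'d topology \<Rightarrow> 'd topology \<Rightarrow> ('d \<Rightarrow> 'y) \<Rightarrow> 'y topology \<Rightarrow>
     'x topology \<Rightarrow> ('y \<Rightarrow> 'x) \<Rightarrow> ('d \<Rightarrow> 'x) \<Rightarrow> bool" where
  "is_pushout A D g Y X i h \<longleftrightarrow>
     topspace X = i ` topspace Y \<union> h ` topspace D \<and>
     inj_on i (topspace Y) \<and>
     (\<forall>u \<in> topspace D. \<forall>y \<in> topspace Y. h u = i y \<longleftrightarrow> u \<in> topspace A \<and> g u = y) \<and>
     (\<forall>u \<in> topspace D. \<forall>v \<in> topspace D.
        h u = h v \<longleftrightarrow> u = v \<or> u \<in> topspace A \<and> v \<in> topspace A \<and> g u = g v) \<and>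
     (\<forall>U. U \<subseteq> topspace X \<longrightarrow>
        (openin X U \<longleftrightarrow>
           openin Y {y \<in> topspace Y. i y \<in> U} \<and> openin D {u \<in> topspace D. h u \<in> U}))"

text \<open>\<open>bubble X ps\<close>: the space \<open>X\<close> is the result of a gluing process, and \<open>ps\<close> lists its pieces
  in the order of their appearance, the sphere first and then the disks. Each piece is recorded as
  its dimension together with the part of it to which further disks may be glued: the sphere,
  respectively the interior of the disk, minus the images of the boundaries of the disks already
  glued to it. The condition \<open>d \<le> e\<close> covers both \<open>d\<close> being at most the dimension of the sphere
  and \<open>d\<close> being at most the dimension of the disk that is glued to.

  All stages of the process live on one type; this is no restriction, as every stage embeds
  into the final space.\<close>

inductive bubble :: "'a topology \<Rightarrow> (nat \<times> 'a set) list \<Rightarrow> bool" where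
  sphere: "2 \<le> n \<Longrightarrow> X homeomorphic_space nsphere n \<Longrightarrow> bubble X [(n, topspace X)]"
| glue: "bubble Y ps \<Longrightarrow> j < length ps \<Longrightarrow> ps ! j = (e, R) \<Longrightarrow> 1 \<le> d \<Longrightarrow> d \<le> e \<Longrightarrow>
    embedding_map (disk_boundary d) Y g \<Longrightarrow> g ` topspace (disk_boundary d) \<subseteq> R \<Longrightarrow>
    is_pushout (disk_boundary d) (disk d) g Y X i h \<Longrightarrow>
    bubble X (map (\<lambda>(k, S). (k, i ` S)) (ps[j := (e, R - g ` topspace (disk_boundary d))])
              @ [(d, h ` disk_interior d)])"

text \<open>\<open>X\<close> consists of a sphere of dimension \<open>n\<close> and of disks whose dimensions, in any order of
  gluing, form the multiset \<open>N\<close>.\<close>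

definition bubble_space :: "nat \<Rightarrow> nat multiset \<Rightarrow> 'a topology \<Rightarrow> bool" where
  "bubble_space n N X \<longleftrightarrow>
     (\<exists>ps. bubble X ps \<and> fst (hd ps) = n \<and> mset (map fst (tl ps)) = N)"

end

theory Submission
  imports Defs
begin

text \<open>The attaching sphere of a disk of dimension \<open>d \<le> e\<close> lies in an \<open>e\<close>-sphere or in an open cell,
  neither of which has reduced homology in degree \<open>d - 1\<close>. So the connecting map of the pair formed
  by the new space and the complement of the center of the new cell vanishes, and each disk adds one
  copy of the integers in its own dimension and changes nothing else. Clearing denominators, the
  rational homology is one-dimensional in the degrees \<open>0\<close> and \<open>n\<^sub>i\<close> and zero elsewhere. Hence the
  Lefschetz numbers are signed power sums of the eigenvalues, and power sums determine a finite
  multiset of nonzero numbers.\<close>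

subsection \<open>Rational chains as fractions of integral chains\<close>

text \<open>Excision wants the closure of the excised set inside the interior of the second
  subspace. The old space is closed, so the pair uses the complement of the new center instead: it
  is open and deforms radially onto the old space. The part of a piece that is still free for gluing
  may have lost several embedded spheres, and then it can have homology of its own. The induction
  therefore remembers a larger subspace for every piece, the whole sphere or the whole open cell
  with which the piece began, and the connecting map factors through that. Because the dimensions
  are distinct, the degree of a new cell is empty before the gluing, so the new group is the
  relative one and no direct sum appears. The topology is done with integer coefficients, where
  excision and the exact sequences are at hand; only groups isomorphic to 0 or to the integers have
  to be transferred. Compactness of the disk yields embeddings only into Hausdorff spaces, and that
  property comes from the simplicial complex. Power sums with positive exponent do not see zero
  eigenvalues, so the permutation concerns the nonzero ones.\<close>

lemma lookup_rat_scale [simp]: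
  "Poly_Mapping.lookup (rat_scale q c) x = q * Poly_Mapping.lookup c x"
  by (simp add: rat_scale_def Poly_Mapping.map.rep_eq when_def)

lemma keys_rat_scale_subset: "Poly_Mapping.keys (rat_scale q c) \<subseteq> Poly_Mapping.keys c"
  by (auto simp: in_keys_iff)

lemma rat_scale_0 [simp]: "rat_scale 0 c = 0" "rat_scale q 0 = 0"
  by (auto intro!: poly_mapping_eqI)

lemma rat_scale_1 [simp]: "rat_scale 1 c = c"
  by (auto intro!: poly_mapping_eqI)

lemma rat_scale_add_left: "rat_scale (q + r) c = rat_scale q c + rat_scale r c"
  by (auto intro!: poly_mapping_eqI simp: lookup_add algebra_simps)

lemma rat_scale_add: "rat_scale q (c + d) = rat_scale q c + rat_scale q d"
  by (auto intro!: poly_mapping_eqI simp: lookup_add algebra_simps)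

lemma rat_scale_diff: "rat_scale q (c - d) = rat_scale q c - rat_scale q d"
  by (rule poly_mapping_eqI) (simp add: lookup_minus right_diff_distrib)

lemma rat_scale_uminus: "rat_scale (-1) c = - c"
  by (auto intro!: poly_mapping_eqI)

lemma rat_scale_scale [simp]: "rat_scale q (rat_scale r c) = rat_scale (q * r) c"
  by (auto intro!: poly_mapping_eqI)

lemma rat_scale_sum: "rat_scale q (sum f A) = (\<Sum>a\<in>A. rat_scale q (f a))"
  by (induction A rule: infinite_finite_induct) (auto simp: rat_scale_add)

text \<open>Coefficients may cancel in a sum of chains, so the supports of two chains and of their
  sum differ. Additivity is read off after all three sums are written over one common finite
  set.\<close>

lemma rat_extend_superset:
  assumes "finite S" "Poly_Mapping.keys c \<subseteq> S"
  shows "rat_extend g c = (\<Sum>s\<in>S. rat_scale (Poly_Mapping.lookup c s) (g s))"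
  unfolding rat_extend_def
  by (rule sum.mono_neutral_left) (use assms in \<open>auto simp: in_keys_iff\<close>)

lemma rat_extend_add: "rat_extend g (c + d) = rat_extend g c + rat_extend g d"
proof -
  let ?S = "Poly_Mapping.keys c \<union> Poly_Mapping.keys d"
  have "Poly_Mapping.keys (c + d) \<subseteq> ?S"
    by (rule Poly_Mapping.keys_add)
  then show ?thesis
    by (simp add: rat_extend_superset [of ?S] lookup_add rat_scale_add_left sum.distrib)
qed

lemma rat_extend_scale: "rat_extend g (rat_scale q c) = rat_scale q (rat_extend g c)"
  using keys_rat_scale_subset [of q c]
  by (simp add: rat_extend_superset [of "Poly_Mapping.keys c"] rat_scale_sum)

lemma rat_extend_0 [simp]: "rat_extend g 0 = 0"
  by (simp add: rat_extend_def)

section \<open>The inclusion of integral chains into rational chains\<close>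

definition rat_of_frag :: "('b \<Rightarrow>\<^sub>0 int) \<Rightarrow> ('b \<Rightarrow>\<^sub>0 rat)" where
  "rat_of_frag c = Poly_Mapping.map of_int c"

lemma lookup_rat_of_frag [simp]:
  "Poly_Mapping.lookup (rat_of_frag c) x = of_int (Poly_Mapping.lookup c x)"
  by (simp add: rat_of_frag_def Poly_Mapping.map.rep_eq when_def)

lemma keys_rat_of_frag [simp]: "Poly_Mapping.keys (rat_of_frag c) = Poly_Mapping.keys c"
  by (auto simp: in_keys_iff)

lemma rat_of_frag_eq_iff [simp]: "rat_of_frag c = rat_of_frag d \<longleftrightarrow> c = d"
  by (auto simp: poly_mapping_eq_iff fun_eq_iff)

lemma rat_of_frag_0 [simp]: "rat_of_frag 0 = 0"
  by (auto intro!: poly_mapping_eqI)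

lemma rat_of_frag_eq_0_iff [simp]: "rat_of_frag c = 0 \<longleftrightarrow> c = 0"
  by (metis rat_of_frag_0 rat_of_frag_eq_iff)

lemma rat_of_frag_add: "rat_of_frag (c + d) = rat_of_frag c + rat_of_frag d"
  by (auto intro!: poly_mapping_eqI simp: lookup_add)

lemma rat_of_frag_diff: "rat_of_frag (c - d) = rat_of_frag c - rat_of_frag d"
  by (auto intro!: poly_mapping_eqI simp: lookup_minus)

lemma rat_of_frag_cmul: "rat_of_frag (frag_cmul k c) = rat_scale (of_int k) (rat_of_frag c)"
  by (auto intro!: poly_mapping_eqI)

lemma rat_of_frag_sum: "rat_of_frag (sum f A) = (\<Sum>a\<in>A. rat_of_frag (f a))"
  by (induction A rule: infinite_finite_induct) (auto simp: rat_of_frag_add)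

lemma rat_of_frag_of: "rat_of_frag (frag_of s) = Poly_Mapping.single s 1"
  by (auto intro!: poly_mapping_eqI simp: lookup_single when_def)

lemma rat_extend_rat_of_frag:
  "rat_extend (\<lambda>s. rat_of_frag (g s)) (rat_of_frag c) = rat_of_frag (frag_extend g c)"
  by (simp add: rat_extend_def frag_extend_def rat_of_frag_sum rat_of_frag_cmul)

lemma rat_boundary_rat_of_frag: "rat_boundary p (rat_of_frag c) = rat_of_frag (chain_boundary p c)"
proof -
  have *: "Poly_Mapping.single (singular_face p k s) ((-1) ^ k) =
      rat_of_frag (frag_cmul ((-1) ^ k) (frag_of (singular_face p k s)))" for k and s :: "(nat \<Rightarrow> real) \<Rightarrow> 'a"
    by (auto intro!: poly_mapping_eqI simp: lookup_single when_def)
  show ?thesis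
    unfolding rat_boundary_def chain_boundary_def
    by (simp add: * rat_extend_rat_of_frag flip: rat_of_frag_sum)
qed

lemma rat_chain_map_rat_of_frag:
  "rat_chain_map p f (rat_of_frag c) = rat_of_frag (chain_map p f c)"
  unfolding rat_chain_map_def chain_map_def
  by (simp add: o_def flip: rat_of_frag_of rat_extend_rat_of_frag)

lemma rat_of_frag_in_rat_chains [simp]:
  "rat_of_frag c \<in> rat_chains p X \<longleftrightarrow> singular_chain p X c"
  by (simp add: rat_chains_def singular_chain_def)

lemma rat_of_frag_in_rat_cycles [simp]:
  "rat_of_frag c \<in> rat_cycles p X \<longleftrightarrow> singular_relcycle p X {} c"
  by (simp add: rat_cycles_def singular_cycle rat_boundary_rat_of_frag)

lemma common_denominator:
  fixes S :: "rat set"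
  assumes "finite S"
  shows "\<exists>N::nat. N > 0 \<and> (\<forall>x\<in>S. of_nat N * x \<in> \<int>)"
  using assms
proof (induction S)
  case empty
  then show ?case by (intro exI [of _ 1]) auto
next
  case (insert x S)
  then obtain N where N: "N > 0" "\<And>y. y \<in> S \<Longrightarrow> of_nat N * y \<in> \<int>"
    by blast
  obtain a b where ab: "quotient_of x = (a, b)"
    by fastforce
  then have b: "b > 0" and x: "x = of_int a / of_int b"
    using quotient_of_denom_pos quotient_of_div by auto
  have "of_nat (N * nat b) * y \<in> \<int>" if "y \<in> insert x S" for y
  proof (cases "y = x")
    case True
    have "of_nat (N * nat b) * y = of_int (int N * a)"
      using b by (simp add: True x)
    then show ?thesis by (metis Ints_of_int)
  next
    case False
    then have "of_nat N * y * of_nat (nat b) \<in> \<int>"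
      by (metis N(2) Ints_mult Ints_of_nat insertE that)
    then show ?thesis by (simp add: mult_ac)
  qed
  then show ?case
    using N b by (intro exI [of _ "N * nat b"]) auto
qed

text \<open>A common denominator of the finitely many coefficients exists. Multiplication by a
  positive number keeps the support, so the integral chain lives in the same space as the rational
  one. Facts on chain maps and boundaries are reduced to integer coefficients through this
  lemma.\<close>

lemma rat_chain_fraction:
  obtains N :: nat and d where "N > 0" "rat_scale (of_nat N) c = rat_of_frag d"
    "Poly_Mapping.keys d = Poly_Mapping.keys c"
proof -
  obtain N :: nat
    where N: "N > 0" "\<And>x. x \<in> Poly_Mapping.lookup c ` Poly_Mapping.keys c \<Longrightarrow> of_nat N * x \<in> \<int>"
    using common_denominator [of "Poly_Mapping.lookup c ` Poly_Mapping.keys c"] by auto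
  define d where "d = Poly_Mapping.map (\<lambda>x. \<lfloor>of_nat N * x\<rfloor>) c"
  have "of_nat N * Poly_Mapping.lookup c s \<in> \<int>" for s
    using N by (cases "s \<in> Poly_Mapping.keys c") (auto simp: in_keys_iff)
  then have "rat_of_frag d = rat_scale (of_nat N) c"
    by (auto intro!: poly_mapping_eqI
        simp: d_def Poly_Mapping.map.rep_eq when_def of_int_floor)
  moreover have "Poly_Mapping.keys (rat_scale (of_nat N) c) = Poly_Mapping.keys c"
    using N by (auto simp: in_keys_iff)
  ultimately show thesis
    using that N by (metis keys_rat_of_frag)
qed

lemma rat_scale_inverse: "q \<noteq> 0 \<Longrightarrow> rat_scale q c = d \<longleftrightarrow> c = rat_scale (inverse q) d"
  by auto

section \<open>Cycles and boundaries as rational subspaces\<close>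

lemma rat_boundary_add: "rat_boundary p (c + d) = rat_boundary p c + rat_boundary p d"
  by (simp add: rat_boundary_def rat_extend_add)

lemma rat_boundary_scale: "rat_boundary p (rat_scale q c) = rat_scale q (rat_boundary p c)"
  by (simp add: rat_boundary_def rat_extend_scale)

lemma rat_chain_map_add: "rat_chain_map p f (c + d) = rat_chain_map p f c + rat_chain_map p f d"
  by (simp add: rat_chain_map_def rat_extend_add)

lemma rat_chain_map_scale:
  "rat_chain_map p f (rat_scale q c) = rat_scale q (rat_chain_map p f c)"
  by (simp add: rat_chain_map_def rat_extend_scale)

lemma rat_chains_add: "c \<in> rat_chains p X \<Longrightarrow> d \<in> rat_chains p X \<Longrightarrow> c + d \<in> rat_chains p X"
  using Poly_Mapping.keys_add [of c d] by (auto simp: rat_chains_def)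

lemma rat_chains_scale: "c \<in> rat_chains p X \<Longrightarrow> rat_scale q c \<in> rat_chains p X"
  using keys_rat_scale_subset [of q c] by (auto simp: rat_chains_def)

lemma zero_in_rat_chains [simp]: "0 \<in> rat_chains p X"
  by (simp add: rat_chains_def)

lemma rat_boundary_0 [simp]: "rat_boundary p 0 = 0"
  by (simp add: rat_boundary_def)

lemma rat_cycles_add: "c \<in> rat_cycles p X \<Longrightarrow> d \<in> rat_cycles p X \<Longrightarrow> c + d \<in> rat_cycles p X"
  by (auto simp: rat_cycles_def rat_chains_add rat_boundary_add)

lemma rat_cycles_scale: "c \<in> rat_cycles p X \<Longrightarrow> rat_scale q c \<in> rat_cycles p X"
  by (auto simp: rat_cycles_def rat_chains_scale rat_boundary_scale)

lemma zero_in_rat_cycles [simp]: "0 \<in> rat_cycles p X"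
  by (simp add: rat_cycles_def)

lemma rat_boundaries_add:
  "c \<in> rat_boundaries p X \<Longrightarrow> d \<in> rat_boundaries p X \<Longrightarrow> c + d \<in> rat_boundaries p X"
  unfolding rat_boundaries_def by (auto simp flip: rat_boundary_add intro!: imageI rat_chains_add)

lemma rat_boundaries_scale: "c \<in> rat_boundaries p X \<Longrightarrow> rat_scale q c \<in> rat_boundaries p X"
  unfolding rat_boundaries_def by (auto simp flip: rat_boundary_scale intro!: imageI rat_chains_scale)

lemma zero_in_rat_boundaries [simp]: "0 \<in> rat_boundaries p X"
  unfolding rat_boundaries_def by (metis image_eqI rat_boundary_0 zero_in_rat_chains)

lemma rat_boundaries_uminus: "c \<in> rat_boundaries p X \<Longrightarrow> - c \<in> rat_boundaries p X"
  by (metis rat_boundaries_scale rat_scale_uminus)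

lemma rat_boundaries_diff:
  "c \<in> rat_boundaries p X \<Longrightarrow> d \<in> rat_boundaries p X \<Longrightarrow> c - d \<in> rat_boundaries p X"
  by (metis rat_boundaries_add rat_boundaries_uminus uminus_add_conv_diff add.commute)

text \<open>Clearing the denominators of a rational chain that bounds \<open>c\<close> multiplies
  \<open>c\<close> by the same \<open>N\<close>. Hence an integral cycle dies over the rationals
  exactly when its class is torsion.\<close>

lemma rat_of_frag_in_rat_boundaries:
  "rat_of_frag c \<in> rat_boundaries p X \<longleftrightarrow>
    (\<exists>N::nat. N > 0 \<and> singular_relboundary p X {} (frag_cmul (int N) c))"
proof
  assume "rat_of_frag c \<in> rat_boundaries p X"
  then obtain b where b: "b \<in> rat_chains (Suc p) X" "rat_of_frag c = rat_boundary (Suc p) b"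
    by (auto simp: rat_boundaries_def)
  obtain N :: nat and d where d: "N > 0" "rat_scale (of_nat N) b = rat_of_frag d"
      "Poly_Mapping.keys d = Poly_Mapping.keys b"
    by (rule rat_chain_fraction)
  have "rat_of_frag (frag_cmul (int N) c) = rat_of_frag (chain_boundary (Suc p) d)"
    using b d by (metis rat_of_frag_cmul of_int_of_nat_eq rat_boundary_scale rat_boundary_rat_of_frag)
  moreover have "singular_chain (Suc p) X d"
    using b d by (simp add: singular_chain_def rat_chains_def)
  ultimately show "\<exists>N::nat. N > 0 \<and> singular_relboundary p X {} (frag_cmul (int N) c)"
    using d(1) by (metis singular_boundary rat_of_frag_eq_iff)
next
  assume "\<exists>N::nat. N > 0 \<and> singular_relboundary p X {} (frag_cmul (int N) c)"
  then obtain N :: nat and d where N: "N > 0" and d: "singular_chain (Suc p) X d"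
      "chain_boundary (Suc p) d = frag_cmul (int N) c"
    by (auto simp: singular_boundary)
  have "rat_scale (of_nat N) (rat_of_frag c) = rat_boundary (Suc p) (rat_of_frag d)"
    by (simp add: rat_boundary_rat_of_frag d rat_of_frag_cmul)
  then have "rat_of_frag c = rat_scale (inverse (of_nat N)) (rat_boundary (Suc p) (rat_of_frag d))"
    using N by (simp add: rat_scale_inverse)
  moreover have "rat_boundary (Suc p) (rat_of_frag d) \<in> rat_boundaries p X"
    using d by (auto simp: rat_boundaries_def)
  ultimately show "rat_of_frag c \<in> rat_boundaries p X"
    by (simp add: rat_boundaries_scale)
qed

section \<open>Chain maps with rational coefficients\<close>

lemma rat_chain_map_in_rat_chains:
  assumes "continuous_map X Y f" "c \<in> rat_chains p X"
  shows "rat_chain_map p f c \<in> rat_chains p Y"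
proof -
  obtain N :: nat and d where d: "N > 0" "rat_scale (of_nat N) c = rat_of_frag d"
      "Poly_Mapping.keys d = Poly_Mapping.keys c"
    by (rule rat_chain_fraction)
  then have "singular_chain p X d"
    using assms by (simp add: singular_chain_def rat_chains_def)
  then have "singular_chain p Y (chain_map p f d)"
    using assms singular_chain_chain_map by blast
  then have "rat_scale (inverse (of_nat N)) (rat_of_frag (chain_map p f d)) \<in> rat_chains p Y"
    by (simp add: rat_chains_scale)
  then show ?thesis
    using d by (simp add: rat_scale_inverse rat_chain_map_scale flip: rat_chain_map_rat_of_frag)
qed

lemma rat_boundary_chain_map:
  assumes "c \<in> rat_chains p X"
  shows "rat_boundary p (rat_chain_map p f c) = rat_chain_map (p - Suc 0) f (rat_boundary p c)"
proof -
  obtain N :: nat and d where d: "N > 0" "rat_scale (of_nat N) c = rat_of_frag d"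
      "Poly_Mapping.keys d = Poly_Mapping.keys c"
    by (rule rat_chain_fraction)
  then have c: "c = rat_scale (inverse (of_nat N)) (rat_of_frag d)" and "singular_chain p X d"
    using assms by (simp_all add: singular_chain_def rat_chains_def rat_scale_inverse)
  then show ?thesis
    using chain_boundary_chain_map [of p X d f]
    by (simp add: c rat_boundary_scale rat_chain_map_scale rat_boundary_rat_of_frag
        rat_chain_map_rat_of_frag)
qed

lemma rat_chain_map_in_rat_cycles:
  assumes "continuous_map X Y f" "c \<in> rat_cycles p X"
  shows "rat_chain_map p f c \<in> rat_cycles p Y"
  using assms rat_chain_map_in_rat_chains [of X Y f c p] rat_boundary_chain_map [of c p X f]
  by (auto simp: rat_cycles_def rat_chain_map_def)

lemma rat_chain_map_in_rat_boundaries: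
  assumes "continuous_map X Y f" "c \<in> rat_boundaries p X"
  shows "rat_chain_map p f c \<in> rat_boundaries p Y"
proof -
  obtain b where b: "b \<in> rat_chains (Suc p) X" "c = rat_boundary (Suc p) b"
    using assms by (auto simp: rat_boundaries_def)
  then show ?thesis
    using rat_chain_map_in_rat_chains [OF assms(1) b(1)] rat_boundary_chain_map [OF b(1), of f]
    by (metis diff_Suc_Suc diff_zero image_eqI rat_boundaries_def)
qed

lemma rat_chain_map_compose:
  "rat_chain_map p (g \<circ> f) c = rat_chain_map p g (rat_chain_map p f c)"
proof -
  obtain N :: nat and d where d: "N > 0" "rat_scale (of_nat N) c = rat_of_frag d"
      "Poly_Mapping.keys d = Poly_Mapping.keys c"
    by (rule rat_chain_fraction)
  then have c: "c = rat_scale (inverse (of_nat N)) (rat_of_frag d)"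
    by (simp add: rat_scale_inverse)
  show ?thesis
    by (simp add: c rat_chain_map_scale rat_chain_map_rat_of_frag chain_map_compose)
qed


subsection \<open>Rational homology classes\<close>

definition rat_class :: "nat \<Rightarrow> 'a topology \<Rightarrow> 'a rat_chain \<Rightarrow> 'a rat_chain set" where
  "rat_class p X z = {z + b | b. b \<in> rat_boundaries p X}"

lemma in_rat_class: "c \<in> rat_class p X z \<longleftrightarrow> c - z \<in> rat_boundaries p X"
  unfolding rat_class_def by (auto intro: exI [of _ "c - z"])

lemma rat_class_eq_iff: "rat_class p X z = rat_class p X w \<longleftrightarrow> z - w \<in> rat_boundaries p X"
proof
  assume "rat_class p X z = rat_class p X w"
  then show "z - w \<in> rat_boundaries p X"
    by (metis in_rat_class diff_self zero_in_rat_boundaries)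
next
  assume zw: "z - w \<in> rat_boundaries p X"
  have "c - z \<in> rat_boundaries p X \<longleftrightarrow> c - w \<in> rat_boundaries p X" for c
    using rat_boundaries_add [OF _ zw, of "c - z"] rat_boundaries_diff [OF _ zw, of "c - w"] by auto
  then show "rat_class p X z = rat_class p X w"
    by (auto simp: in_rat_class)
qed

lemma carrier_rat_homology: "carrier (rat_homology p X) = rat_class p X ` rat_cycles p X"
  by (simp add: rat_homology_def rat_class_def)

lemma zero_rat_homology: "\<zero>\<^bsub>rat_homology p X\<^esub> = rat_class p X 0"
  by (simp add: rat_homology_def rat_class_def)

lemma add_rat_homology:
  "rat_class p X z \<oplus>\<^bsub>rat_homology p X\<^esub> rat_class p X w = rat_class p X (z + w)"
proof -
  have "c \<in> {c + d |c d. c \<in> rat_class p X z \<and> d \<in> rat_class p X w} \<longleftrightarrow> c \<in> rat_class p X (z + w)" for c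
  proof
    assume "c \<in> rat_class p X (z + w)"
    then have "c - w \<in> rat_class p X z" "w \<in> rat_class p X w"
      by (auto simp: in_rat_class diff_diff_eq add.commute)
    then show "c \<in> {c + d |c d. c \<in> rat_class p X z \<and> d \<in> rat_class p X w}"
      by force
  next
    assume "c \<in> {c + d |c d. c \<in> rat_class p X z \<and> d \<in> rat_class p X w}"
    then obtain a b where "c = (z + a) + (w + b)" "a \<in> rat_boundaries p X" "b \<in> rat_boundaries p X"
      by (auto simp: rat_class_def)
    then show "c \<in> rat_class p X (z + w)"
      by (auto simp: in_rat_class intro: rat_boundaries_add)
  qed
  then show ?thesis
    unfolding rat_homology_def by auto
qed

lemma smult_rat_homology:
  "q \<odot>\<^bsub>rat_homology p X\<^esub> rat_class p X z = rat_class p X (rat_scale q z)"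
proof -
  have "c \<in> {rat_scale q c + b |c b. c \<in> rat_class p X z \<and> b \<in> rat_boundaries p X}
      \<longleftrightarrow> c \<in> rat_class p X (rat_scale q z)" for c
  proof
    assume "c \<in> rat_class p X (rat_scale q z)"
    then obtain b where "c = rat_scale q z + b" "b \<in> rat_boundaries p X"
      by (auto simp: rat_class_def)
    moreover have "z \<in> rat_class p X z"
      by (simp add: in_rat_class)
    ultimately show "c \<in> {rat_scale q c + b |c b. c \<in> rat_class p X z \<and> b \<in> rat_boundaries p X}"
      by blast
  next
    assume "c \<in> {rat_scale q c + b |c b. c \<in> rat_class p X z \<and> b \<in> rat_boundaries p X}"
    then obtain a b where "c = rat_scale q (z + a) + b" "a \<in> rat_boundaries p X" "b \<in> rat_boundaries p X"
      by (auto simp: rat_class_def)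
    then show "c \<in> rat_class p X (rat_scale q z)"
      by (auto simp: in_rat_class rat_scale_add intro: rat_boundaries_add rat_boundaries_scale)
  qed
  then show ?thesis
    unfolding rat_homology_def by auto
qed

lemma rat_hom_induced_class:
  assumes "continuous_map X Y f"
  shows "rat_hom_induced p X Y f (rat_class p X z) = rat_class p Y (rat_chain_map p f z)"
proof -
  have "c \<in> rat_hom_induced p X Y f (rat_class p X z) \<longleftrightarrow> c \<in> rat_class p Y (rat_chain_map p f z)" for c
  proof
    assume "c \<in> rat_class p Y (rat_chain_map p f z)"
    then obtain b where "c = rat_chain_map p f z + b" "b \<in> rat_boundaries p Y"
      by (auto simp: rat_class_def)
    moreover have "z \<in> rat_class p X z"
      by (simp add: in_rat_class)
    ultimately show "c \<in> rat_hom_induced p X Y f (rat_class p X z)"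
      unfolding rat_hom_induced_def by blast
  next
    assume "c \<in> rat_hom_induced p X Y f (rat_class p X z)"
    then obtain a b where "c = rat_chain_map p f (z + a) + b" "a \<in> rat_boundaries p X" "b \<in> rat_boundaries p Y"
      by (auto simp: rat_class_def rat_hom_induced_def)
    then show "c \<in> rat_class p Y (rat_chain_map p f z)"
      by (auto simp: in_rat_class rat_chain_map_add
          intro: rat_boundaries_add rat_chain_map_in_rat_boundaries [OF assms])
  qed
  then show ?thesis
    by blast
qed

lemma abelian_monoid_rat_homology: "abelian_monoid (rat_homology p X)"
  by (rule abelian_monoidI)
    (auto simp: carrier_rat_homology zero_rat_homology add_rat_homology add_ac rat_cycles_add)


subsection \<open>Trivial and one-dimensional rational vector spaces\<close>

text \<open>The basis in \<open>endo_trace\<close> is an arbitrary choice, so every possible basis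
  matters. A zero vector in \<open>B\<close> could carry any coefficient, against uniqueness; this
  leaves the empty basis and the empty sum.\<close>

lemma endo_trace_trivial:
  assumes "abelian_monoid M" "carrier M = {\<zero>\<^bsub>M\<^esub>}" "\<And>q. q \<odot>\<^bsub>M\<^esub> \<zero>\<^bsub>M\<^esub> = \<zero>\<^bsub>M\<^esub>"
  shows "endo_trace M T = 0"
proof (cases "\<exists>B. finite_basis M B")
  case True
  define B where "B = (SOME B. finite_basis M B)"
  have "finite_basis M B"
    unfolding B_def using True by (rule someI_ex)
  then have B: "finite B" "B \<subseteq> {\<zero>\<^bsub>M\<^esub>}"
    and ex1: "\<exists>!a. a \<in> extensional B \<and> \<zero>\<^bsub>M\<^esub> = (\<Oplus>\<^bsub>M\<^esub>b\<in>B. a b \<odot>\<^bsub>M\<^esub> b)"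
    using assms(2) by (auto simp: finite_basis_def)
  have sum0: "(\<Oplus>\<^bsub>M\<^esub>b\<in>B. a b \<odot>\<^bsub>M\<^esub> b) = \<zero>\<^bsub>M\<^esub>" for a
  proof -
    have "(\<Oplus>\<^bsub>M\<^esub>b\<in>B. a b \<odot>\<^bsub>M\<^esub> b) = (\<Oplus>\<^bsub>M\<^esub>b\<in>B. \<zero>\<^bsub>M\<^esub>)"
      by (rule abelian_monoid.finsum_cong' [OF assms(1)])
        (use B assms(2,3) in \<open>auto simp: subset_singleton_iff\<close>)
    then show ?thesis
      using abelian_monoid.finsum_zero [OF assms(1)] by simp
  qed
  have "B = {}"
  proof (rule ccontr)
    assume "B \<noteq> {}"
    then obtain b where "b \<in> B" by blast
    moreover have "(\<lambda>x\<in>B. 0) = (\<lambda>x\<in>B. 1::rat)"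
      using ex1 sum0 by (metis restrict_extensional)
    ultimately show False
      by (metis restrict_apply' zero_neq_one)
  qed
  then show ?thesis
    by (simp add: endo_trace_def flip: B_def)
qed (simp add: endo_trace_def)

text \<open>The scalar laws are asked only on multiples of \<open>v\<close>, which make up the whole
  carrier. The axiom \<open>smult_eq_iff\<close> says that \<open>v\<close> is nonzero and
  torsion-free.\<close>

locale rat_line = abelian_monoid M for M :: "(rat, 'v) module" (structure) +
  fixes v :: 'v
  assumes carrier_eq: "carrier M = range (\<lambda>q. q \<odot> v)"
    and smult_eq_iff: "q \<odot> v = r \<odot> v \<longleftrightarrow> q = r"
    and smult_add: "(q + r) \<odot> v = (q \<odot> v) \<oplus> (r \<odot> v)"
    and smult_smult: "q \<odot> (r \<odot> v) = (q * r) \<odot> v"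
    and smult_zero: "0 \<odot> v = \<zero>"
    and smult_one: "1 \<odot> v = v"
begin

lemma finsum_smult:
  assumes "finite B" "\<And>b. b \<in> B \<Longrightarrow> b = \<beta> b \<odot> v"
  shows "(\<Oplus>b\<in>B. a b \<odot> b) = (\<Sum>b\<in>B. a b * \<beta> b) \<odot> v"
  using assms
proof (induction B)
  case empty
  then show ?case by (simp add: smult_zero)
next
  case (insert b B)
  have eq: "a x \<odot> x = (a x * \<beta> x) \<odot> v" if "x \<in> insert b B" for x
    using arg_cong [OF insert.prems [OF that], of "\<lambda>y. a x \<odot> y"] unfolding smult_smult .
  then have "(\<lambda>x. a x \<odot> x) \<in> B \<rightarrow> carrier M" "a b \<odot> b \<in> carrier M"
    by (auto simp: carrier_eq)
  then have "(\<Oplus>x\<in>insert b B. a x \<odot> x) = (a b \<odot> b) \<oplus> (\<Oplus>x\<in>B. a x \<odot> x)"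
    using insert.hyps by (intro finsum_insert) auto
  also have "\<dots> = (a b * \<beta> b) \<odot> v \<oplus> (\<Sum>b\<in>B. a b * \<beta> b) \<odot> v"
    using insert.IH [OF insert.prems] eq [of b] by simp
  finally show ?case
    using insert.hyps by (simp add: smult_add)
qed

lemma finite_basis_singleton: "finite_basis M {v}"
proof -
  have fs: "(\<Oplus>b\<in>{v}. a b \<odot> b) = a v \<odot> v" for a
    using finsum_smult [of "{v}" "\<lambda>_. 1" a] smult_one by simp
  have "\<exists>!a. a \<in> extensional {v} \<and> q \<odot> v = a v \<odot> v" for q
  proof (rule ex1I [of _ "\<lambda>x\<in>{v}. q"])
    fix a
    assume "a \<in> extensional {v} \<and> q \<odot> v = a v \<odot> v"
    then show "a = (\<lambda>x\<in>{v}. q)"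
      by (intro extensionalityI [of _ "{v}"]) (auto simp: smult_eq_iff)
  qed auto
  moreover have "v \<in> carrier M"
    by (metis carrier_eq rangeI smult_one)
  ultimately show ?thesis
    unfolding finite_basis_def fs by (auto simp: carrier_eq)
qed

text \<open>Needed because the trace is taken in an unknown basis. Uniqueness of coordinates is
  turned into linear independence, which excludes both a zero vector and two different multiples of
  \<open>v\<close>.\<close>

lemma finite_basis_cases:
  assumes "finite_basis M B"
  obtains \<beta> where "\<beta> \<noteq> 0" "B = {\<beta> \<odot> v}"
proof -
  have fin: "finite B" and sub: "B \<subseteq> range (\<lambda>q. q \<odot> v)"
    and ex1: "\<And>q. \<exists>!a. a \<in> extensional B \<and> q \<odot> v = (\<Oplus>b\<in>B. a b \<odot> b)"
    using assms by (auto simp: finite_basis_def carrier_eq)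
  have "\<forall>b\<in>B. \<exists>q. b = q \<odot> v"
    using sub by blast
  then obtain \<beta> where \<beta>: "\<And>b. b \<in> B \<Longrightarrow> b = \<beta> b \<odot> v"
    by (metis bchoice)
  have fs: "(\<Oplus>b\<in>B. a b \<odot> b) = (\<Sum>b\<in>B. a b * \<beta> b) \<odot> v" for a
    by (rule finsum_smult [OF fin \<beta>])
  have ex: "\<exists>!a. a \<in> extensional B \<and> q = (\<Sum>b\<in>B. a b * \<beta> b)" for q
    using ex1 [of q] unfolding fs smult_eq_iff .
  have "B \<noteq> {}"
  proof
    assume "B = {}"
    then show False using ex [of 1] by auto
  qed
  then obtain b where b: "b \<in> B" by blast
  have uniq: "a x = 0" if "(\<Sum>b\<in>B. a b * \<beta> b) = 0" "x \<in> B" for a x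
  proof -
    \<comment> \<open>Uniqueness is available only among coefficient functions that are extensional
      on \<open>B\<close>, hence the restrictions.\<close>
    have "(\<Sum>b\<in>B. restrict a B b * \<beta> b) = 0" "(\<Sum>b\<in>B. restrict (\<lambda>_. 0) B b * \<beta> b) = 0"
      using that by (simp_all cong: sum.cong)
    then have "restrict a B = restrict (\<lambda>_. 0) B"
      using ex [of 0] by (metis restrict_extensional)
    then show ?thesis
      using that by (metis restrict_apply')
  qed
  have nz: "\<beta> x \<noteq> 0" if "x \<in> B" for x
  proof
    assume "\<beta> x = 0"
    then have "(\<Sum>b\<in>B. (if b = x then 1 else 0) * \<beta> b) = 0"
      by (intro sum.neutral) auto
    then show False
      using uniq [of "\<lambda>b. if b = x then 1 else 0" x] that by simp
  qed
  have "x = b" if x: "x \<in> B" for x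
  proof (rule ccontr)
    assume ne: "x \<noteq> b"
    \<comment> \<open>These are the coefficients of the linear relation \<beta>(b)\<beta>(x) -
      \<beta>(x)\<beta>(b) = 0 between the two multiples \<open>x\<close> and \<open>b\<close> of
      \<open>v\<close>.\<close>
    let ?a = "\<lambda>y. (if y = x then \<beta> b else 0) - (if y = b then \<beta> x else 0)"
    have "(\<Sum>y\<in>B. ?a y * \<beta> y) =
        (\<Sum>y\<in>B. if y = x then \<beta> b * \<beta> y else 0) - (\<Sum>y\<in>B. if y = b then \<beta> x * \<beta> y else 0)"
      unfolding sum_subtractf [symmetric] by (rule sum.cong) (auto simp: algebra_simps)
    also have "\<dots> = 0"
      using fin x b by simp
    finally have "?a x = 0"
      using uniq [of ?a x] x by blast
    then show False
      using ne nz [OF b] by simp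
  qed
  then have "B = {b}"
    using b by blast
  also have "{b} = {\<beta> b \<odot> v}"
    by (rule arg_cong [OF \<beta> [OF b]])
  finally show thesis
    by (rule that [OF nz [OF b]])
qed

text \<open>Whatever multiple of \<open>v\<close> the choice returns as basis vector, its factor
  \<beta> occurs on both sides of the coordinate equation and cancels.\<close>

lemma endo_trace_eq:
  assumes T: "\<And>q. T (q \<odot> v) = (l * q) \<odot> v"
  shows "endo_trace M T = l"
proof -
  define B where "B = (SOME B. finite_basis M B)"
  have "finite_basis M B"
    unfolding B_def by (rule someI [of "finite_basis M", OF finite_basis_singleton])
  then obtain \<beta> where \<beta>: "\<beta> \<noteq> 0" "B = {\<beta> \<odot> v}"
    by (rule finite_basis_cases)
  define c where "c = \<beta> \<odot> v"
  have B: "B = {c}"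
    by (simp add: c_def \<beta>(2))
  have fs: "(\<Oplus>b\<in>B. a b \<odot> b) = (a c * \<beta>) \<odot> v" for a
  proof -
    have "(\<Oplus>b\<in>{c}. a b \<odot> b) = (\<Sum>b\<in>{c}. a b * \<beta>) \<odot> v"
      by (rule finsum_smult) (auto simp: c_def)
    then show ?thesis
      by (simp add: B)
  qed
  have "T c = (l * \<beta>) \<odot> v"
    unfolding c_def by (rule T)
  then have "coords M B (T c) = (THE a. a \<in> extensional B \<and> l * \<beta> = a c * \<beta>)"
    by (simp only: coords_def fs smult_eq_iff)
  also have "\<dots> = (\<lambda>x\<in>B. l)"
  proof (rule the_equality)
    fix a
    assume "a \<in> extensional B \<and> l * \<beta> = a c * \<beta>"
    then show "a = (\<lambda>x\<in>B. l)"
      using \<beta>(1) by (intro extensionalityI [of _ B]) (auto simp: B)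
  qed (simp add: B)
  finally have "(\<Sum>b\<in>B. coords M B (T b) b) = l"
    by (simp add: B)
  then show ?thesis
    unfolding endo_trace_def using finite_basis_singleton by (auto simp: Let_def simp flip: B_def)
qed

lemma endo_eigenvalue_iff:
  assumes T: "\<And>q. T (q \<odot> v) = (l * q) \<odot> v"
  shows "endo_eigenvalue M T k \<longleftrightarrow> k = l"
proof
  assume "endo_eigenvalue M T k"
  then obtain q where "q \<odot> v \<noteq> \<zero>" "(l * q) \<odot> v = k \<odot> (q \<odot> v)"
    by (auto simp: endo_eigenvalue_def carrier_eq T)
  then have "q \<noteq> 0" "l * q = k * q"
    by (auto simp: smult_zero smult_smult smult_eq_iff)
  then show "k = l"
    by simp
next
  assume "k = l"
  moreover have "T v = l \<odot> v"
    using T [of 1] smult_one by simp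
  moreover have "v \<in> carrier M" "v \<noteq> \<zero>"
    using smult_one smult_zero smult_eq_iff [of 1 0] by (auto simp: carrier_eq image_iff) metis
  ultimately show "endo_eigenvalue M T k"
    by (auto simp: endo_eigenvalue_def)
qed

end


subsection \<open>Rational homology from integral homology\<close>

lemma rat_cycle_fraction:
  assumes "z \<in> rat_cycles p X"
  obtains N :: nat and c where "N > 0" "rat_scale (of_nat N) z = rat_of_frag c" "singular_relcycle p X {} c"
proof -
  obtain N :: nat and c where "N > 0" "rat_scale (of_nat N) z = rat_of_frag c"
    "Poly_Mapping.keys c = Poly_Mapping.keys z"
    by (rule rat_chain_fraction)
  moreover from this have "singular_relcycle p X {} c"
    using rat_cycles_scale [OF assms, of "of_nat N"] by simp
  ultimately show thesis
    using that by blast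
qed

lemma carrier_rat_homology_trivial:
  assumes "trivial_group (homology_group (int p) X)"
  shows "carrier (rat_homology p X) = {\<zero>\<^bsub>rat_homology p X\<^esub>}"
proof -
  have "z \<in> rat_boundaries p X" if z: "z \<in> rat_cycles p X" for z
  proof -
    obtain N :: nat and c where c: "N > 0" "rat_scale (of_nat N) z = rat_of_frag c" "singular_relcycle p X {} c"
      using z by (rule rat_cycle_fraction)
    have "homologous_rel_set p X {} c \<in> carrier (homology_group (int p) X)"
      using c by (auto simp: carrier_relative_homology_group)
    then have "homologous_rel_set p X {} c = singular_relboundary_set p X {}"
      using assms by (auto simp: trivial_group_def)
    then have "singular_relboundary p X {} c"
      by (simp add: homologous_rel_set_eq_relboundary)
    then have "rat_of_frag c \<in> rat_boundaries p X"
      unfolding rat_of_frag_in_rat_boundaries by (intro exI [of _ 1]) simp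
    then show ?thesis
      using c by (metis rat_boundaries_scale rat_scale_inverse of_nat_0_eq_iff less_numeral_extra(3))
  qed
  then have "rat_class p X z = rat_class p X 0" if "z \<in> rat_cycles p X" for z
    using that by (simp add: rat_class_eq_iff)
  then show ?thesis
    using zero_in_rat_cycles [of p X] unfolding carrier_rat_homology zero_rat_homology by blast
qed

lemma endo_trace_rat_homology_trivial:
  assumes "trivial_group (homology_group (int p) X)"
  shows "endo_trace (rat_homology p X) T = 0"
  by (rule endo_trace_trivial)
    (auto simp: abelian_monoid_rat_homology carrier_rat_homology_trivial [OF assms]
      zero_rat_homology smult_rat_homology)

text \<open>Homology groups are written multiplicatively while chains are added, so a power of a
  class is the class of a multiple of the cycle.\<close>

lemma homologous_rel_set_pow:
  assumes "singular_relcycle p X {} z"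
  shows "homologous_rel_set p X {} z [^]\<^bsub>homology_group (int p) X\<^esub> (k::int)
     = homologous_rel_set p X {} (frag_cmul k z)"
proof -
  have "Poly_Mapping.keys z \<subseteq> singular_simplex_set p X"
    using assms by (auto simp: singular_cycle singular_chain_def)
  moreover have "z \<in> carrier (subgroup_generated
      (free_Abelian_group (singular_simplex_set p X)) (singular_relcycle_set p X {}))"
    by (metis assms carrier_relcycle_group chain_group_def mem_Collect_eq relcycle_group_def)
  ultimately have "z [^]\<^bsub>relcycle_group p X {}\<^esub> k = frag_cmul k z"
    by (simp add: relcycle_group_def chain_group_def group.int_pow_subgroup_generated)
  then show ?thesis
    using normal.FactGroup_int_pow [OF normal_subgroup_singular_relboundary_relcycle, of z p X "{}" k] assms
    by (simp add: relative_homology_group_def right_coset_singular_relboundary)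
qed

text \<open>Surjectivity of the powers makes each integral cycle homologous to a multiple of
  \<open>z\<close>, and after a division \<open>z\<close> spans the rational homology. Injectivity
  says that the class of \<open>z\<close> has infinite order, so no nonzero rational multiple of
  \<open>z\<close> is a boundary.\<close>

lemma rat_line_homology:
  assumes z: "singular_relcycle p X {} z"
    and iso: "(\<lambda>k. homologous_rel_set p X {} z [^]\<^bsub>homology_group (int p) X\<^esub> k)
       \<in> iso integer_group (homology_group (int p) X)"
  shows "rat_line (rat_homology p X) (rat_class p X (rat_of_frag z))"
proof -
  let ?H = "homology_group (int p) X" and ?z = "rat_of_frag z"
  have multiple: "\<exists>k. singular_relboundary p X {} (c - frag_cmul k z)"
    if c: "singular_relcycle p X {} c" for c
  proof -
    have "homologous_rel_set p X {} c \<in> carrier ?H"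
      using c by (auto simp: carrier_relative_homology_group)
    then obtain k where "homologous_rel_set p X {} c = homologous_rel_set p X {} z [^]\<^bsub>?H\<^esub> (k::int)"
      using iso by (auto simp: iso_def bij_betw_def)
    then show ?thesis
      by (metis homologous_rel_set_pow [OF z] homologous_rel_set_eq homologous_rel_def)
  qed
  have torsion_free: "k = 0" if "singular_relboundary p X {} (frag_cmul k z)" for k
  proof -
    have "homologous_rel_set p X {} z [^]\<^bsub>?H\<^esub> k = \<one>\<^bsub>?H\<^esub>"
      using that
      by (simp only: homologous_rel_set_pow [OF z] one_relative_homology_group homologous_rel_set_eq_relboundary)
    then have "homologous_rel_set p X {} z [^]\<^bsub>?H\<^esub> k = homologous_rel_set p X {} z [^]\<^bsub>?H\<^esub> (0::int)"
      by (simp only: int_pow_0)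
    moreover have "inj (\<lambda>k::int. homologous_rel_set p X {} z [^]\<^bsub>?H\<^esub> k)"
      using iso by (simp add: iso_def bij_betw_def)
    ultimately show ?thesis
      by (rule injD [rotated])
  qed
  have span: "\<exists>q. w - rat_scale q ?z \<in> rat_boundaries p X" if w: "w \<in> rat_cycles p X" for w
  proof -
    obtain N :: nat and c where c: "N > 0" "rat_scale (of_nat N) w = rat_of_frag c" "singular_relcycle p X {} c"
      using w by (rule rat_cycle_fraction)
    obtain k where "singular_relboundary p X {} (c - frag_cmul k z)"
      using multiple c by blast
    then have "rat_of_frag (c - frag_cmul k z) \<in> rat_boundaries p X"
      unfolding rat_of_frag_in_rat_boundaries by (intro exI [of _ 1]) simp
    then have "rat_scale (inverse (of_nat N)) (rat_of_frag (c - frag_cmul k z)) \<in> rat_boundaries p X"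
      by (rule rat_boundaries_scale)
    \<comment> \<open>Since \<open>N\<close> times \<open>w\<close> is \<open>c\<close>, and
      \<open>c\<close> is homologous to \<open>k\<close> times \<open>z\<close>, the coordinate of
      \<open>w\<close> is \<open>k / N\<close>.\<close>
    moreover have "rat_scale (inverse (of_nat N)) (rat_of_frag (c - frag_cmul k z)) =
        w - rat_scale (of_int k / of_nat N) ?z"
    proof (rule poly_mapping_eqI)
      fix x
      have "of_int (Poly_Mapping.lookup c x) = of_nat N * Poly_Mapping.lookup w x"
        using arg_cong [OF c(2), of "\<lambda>m. Poly_Mapping.lookup m x"] by simp
      then show "Poly_Mapping.lookup (rat_scale (inverse (of_nat N)) (rat_of_frag (c - frag_cmul k z))) x =
          Poly_Mapping.lookup (w - rat_scale (of_int k / of_nat N) ?z) x"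
        using c(1) by (simp add: lookup_minus field_simps)
    qed
    ultimately show ?thesis
      by (metis (no_types))
  qed
  have free: "q = 0" if "rat_scale q ?z \<in> rat_boundaries p X" for q
  proof -
    obtain a b where "quotient_of q = (a, b)"
      by fastforce
    then have b: "b > 0" and q: "q = of_int a / of_int b"
      using quotient_of_denom_pos quotient_of_div by auto
    have "rat_scale (of_int b) (rat_scale q ?z) \<in> rat_boundaries p X"
      by (rule rat_boundaries_scale [OF that])
    also have "rat_scale (of_int b) (rat_scale q ?z) = rat_of_frag (frag_cmul a z)"
      using b by (simp add: q rat_of_frag_cmul)
    finally have "rat_of_frag (frag_cmul a z) \<in> rat_boundaries p X" .
    then obtain N :: nat where "N > 0" "singular_relboundary p X {} (frag_cmul (int N * a) z)"
      by (auto simp: rat_of_frag_in_rat_boundaries)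
    then have "a = 0"
      using torsion_free [of "int N * a"] by simp
    then show ?thesis
      by (simp add: q)
  qed
  interpret abelian_monoid "rat_homology p X"
    by (rule abelian_monoid_rat_homology)
  show ?thesis
  proof
    show "carrier (rat_homology p X) = range (\<lambda>q. q \<odot>\<^bsub>rat_homology p X\<^esub> rat_class p X ?z)"
      unfolding carrier_rat_homology smult_rat_homology
    proof (intro equalityI image_subsetI)
      fix w
      assume "w \<in> rat_cycles p X"
      then obtain q where "rat_class p X w = rat_class p X (rat_scale q ?z)"
        using span unfolding rat_class_eq_iff by blast
      then show "rat_class p X w \<in> range (\<lambda>q. rat_class p X (rat_scale q ?z))"
        by (rule range_eqI)
    next
      fix q :: rat
      have "?z \<in> rat_cycles p X"
        using z by simp
      then show "rat_class p X (rat_scale q ?z) \<in> rat_class p X ` rat_cycles p X"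
        by (intro imageI rat_cycles_scale)
    qed
    fix q r :: rat
    have "rat_scale q ?z - rat_scale r ?z = rat_scale (q - r) ?z"
      by (rule poly_mapping_eqI) (simp add: lookup_minus left_diff_distrib)
    then show "q \<odot>\<^bsub>rat_homology p X\<^esub> rat_class p X ?z = r \<odot>\<^bsub>rat_homology p X\<^esub> rat_class p X ?z
      \<longleftrightarrow> q = r"
      using free [of "q - r"] by (auto simp: smult_rat_homology rat_class_eq_iff)
  qed (auto simp: smult_rat_homology add_rat_homology zero_rat_homology rat_scale_add_left)
qed

lemma cyclic_homology_generator:
  assumes "homology_group (int p) X \<cong> integer_group"
  obtains z where "singular_relcycle p X {} z"
    "(\<lambda>k. homologous_rel_set p X {} z [^]\<^bsub>homology_group (int p) X\<^esub> k)
       \<in> iso integer_group (homology_group (int p) X)"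
proof -
  let ?H = "homology_group (int p) X"
  obtain h where h: "h \<in> iso integer_group ?H"
    using assms by (metis group.iso_sym group_relative_homology_group is_iso_def ex_in_conv)
  then interpret group_hom integer_group ?H h
    by (simp add: group_hom_def group_hom_axioms_def iso_imp_homomorphism)
  have "h 1 \<in> carrier ?H"
    by simp
  then obtain z where z: "singular_relcycle p X {} z" "h 1 = homologous_rel_set p X {} z"
    by (auto simp: carrier_relative_homology_group)
  have "h k = h 1 [^]\<^bsub>?H\<^esub> k" for k
    using hom_int_pow [of 1 k] by simp
  then have "h = (\<lambda>k. homologous_rel_set p X {} z [^]\<^bsub>?H\<^esub> k)"
    by (simp add: z fun_eq_iff)
  then show thesis
    using that z h by simp
qed

section \<open>Traces of the maps induced by iterates\<close>

lemma continuous_map_funpow: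
  assumes "continuous_map X X f"
  shows "continuous_map X X (f ^^ m)"
proof (induction m)
  case (Suc m)
  then show ?case
    using continuous_map_compose [OF Suc assms] by (simp only: funpow.simps)
qed simp

text \<open>A single scalar \<open>l\<close> serves all iterates: modulo boundaries the chain map of
  \<open>f\<close> multiplies \<open>z\<close> by \<open>l\<close>, and since it preserves
  boundaries this can be repeated.\<close>

lemma rat_hom_induced_line:
  assumes f: "continuous_map X X f" and z: "z \<in> rat_cycles p X"
    and line: "rat_line (rat_homology p X) (rat_class p X z)"
  obtains l where "\<And>m q. rat_hom_induced p X X (f ^^ m) (q \<odot>\<^bsub>rat_homology p X\<^esub> rat_class p X z) =
     (l ^ m * q) \<odot>\<^bsub>rat_homology p X\<^esub> rat_class p X z"
proof -
  interpret rat_line "rat_homology p X" "rat_class p X z"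
    by (rule line)
  have "rat_class p X (rat_chain_map p f z) \<in> carrier (rat_homology p X)"
    using rat_chain_map_in_rat_cycles [OF f z] by (simp add: carrier_rat_homology)
  then obtain l where "rat_class p X (rat_chain_map p f z) = rat_class p X (rat_scale l z)"
    by (auto simp: carrier_eq smult_rat_homology)
  then have l: "rat_chain_map p f z - rat_scale l z \<in> rat_boundaries p X"
    by (simp add: rat_class_eq_iff)
  have fm: "continuous_map X X (f ^^ m)" for m
    by (rule continuous_map_funpow [OF f])
  have pow: "rat_chain_map p (f ^^ m) z - rat_scale (l ^ m) z \<in> rat_boundaries p X" for m
  proof (induction m)
    case 0
    \<comment> \<open>The chain map of the identity restricts each simplex to the standard simplex,
      so it fixes chains of singular simplices; that fact is taken over from an integral multiple of
      \<open>z\<close>.\<close>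
    obtain N :: nat and c where c: "N > 0" "rat_scale (of_nat N) z = rat_of_frag c" "singular_relcycle p X {} c"
      using z by (rule rat_cycle_fraction)
    then have "z = rat_scale (inverse (of_nat N)) (rat_of_frag c)"
      by (simp add: rat_scale_inverse)
    moreover have "chain_map p (\<lambda>x. x) c = c"
      using c by (intro chain_map_id_gen) (auto simp: singular_cycle)
    ultimately show ?case
      by (simp add: id_def rat_chain_map_scale rat_chain_map_rat_of_frag)
  next
    case (Suc m)
    have "rat_chain_map p f (rat_chain_map p (f ^^ m) z - rat_scale (l ^ m) z) \<in> rat_boundaries p X"
      by (rule rat_chain_map_in_rat_boundaries [OF f Suc])
    moreover have "rat_chain_map p f (rat_chain_map p (f ^^ m) z - rat_scale (l ^ m) z) +
        rat_scale (l ^ m) (rat_chain_map p f z) = rat_chain_map p (f ^^ Suc m) z"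
      by (simp add: rat_chain_map_compose flip: rat_chain_map_scale rat_chain_map_add)
    ultimately have "rat_chain_map p (f ^^ Suc m) z - rat_scale (l ^ m) (rat_chain_map p f z) \<in> rat_boundaries p X"
      by (metis add_diff_cancel_right')
    moreover have "rat_scale (l ^ m) (rat_chain_map p f z - rat_scale l z) \<in> rat_boundaries p X"
      by (rule rat_boundaries_scale [OF l])
    ultimately have "rat_chain_map p (f ^^ Suc m) z - rat_scale (l ^ m) (rat_chain_map p f z) +
       rat_scale (l ^ m) (rat_chain_map p f z - rat_scale l z) \<in> rat_boundaries p X"
      by (rule rat_boundaries_add)
    also have "rat_chain_map p (f ^^ Suc m) z - rat_scale (l ^ m) (rat_chain_map p f z) +
       rat_scale (l ^ m) (rat_chain_map p f z - rat_scale l z) =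
       rat_chain_map p (f ^^ Suc m) z - rat_scale (l ^ Suc m) z"
      by (auto intro!: poly_mapping_eqI simp: lookup_minus lookup_add algebra_simps)
    finally show ?case .
  qed
  have "rat_chain_map p (f ^^ m) (rat_scale q z) - rat_scale (l ^ m * q) z \<in> rat_boundaries p X" for m q
    using rat_boundaries_scale [OF pow, of q m]
    by (simp add: rat_chain_map_scale rat_scale_diff mult.commute)
  then have "rat_hom_induced p X X (f ^^ m) (q \<odot>\<^bsub>rat_homology p X\<^esub> rat_class p X z) =
     (l ^ m * q) \<odot>\<^bsub>rat_homology p X\<^esub> rat_class p X z" for m q
    by (simp add: smult_rat_homology rat_hom_induced_class [OF fm] rat_class_eq_iff)
  then show thesis
    by (rule that)
qed

text \<open>The scalar that governs all iterates is, for the first iterate, the only eigenvalue. So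
  the \<open>THE\<close> in \<open>hom_eigenvalue\<close> denotes it.\<close>

lemma endo_trace_rat_homology_cyclic:
  assumes "continuous_map X X f" "homology_group (int p) X \<cong> integer_group"
  shows "endo_trace (rat_homology p X) (rat_hom_induced p X X (f ^^ m)) = hom_eigenvalue p X f ^ m"
proof -
  obtain z where z: "singular_relcycle p X {} z"
    "(\<lambda>k. homologous_rel_set p X {} z [^]\<^bsub>homology_group (int p) X\<^esub> k)
       \<in> iso integer_group (homology_group (int p) X)"
    using assms(2) by (rule cyclic_homology_generator)
  then interpret rat_line "rat_homology p X" "rat_class p X (rat_of_frag z)"
    by (rule rat_line_homology)
  obtain l where l: "\<And>m q. rat_hom_induced p X X (f ^^ m) (q \<odot>\<^bsub>rat_homology p X\<^esub> rat_class p X (rat_of_frag z)) =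
     (l ^ m * q) \<odot>\<^bsub>rat_homology p X\<^esub> rat_class p X (rat_of_frag z)"
    using rat_hom_induced_line [OF assms(1), of "rat_of_frag z" p] z(1) rat_line_axioms by auto
  have "hom_eigenvalue p X f = l"
    unfolding hom_eigenvalue_def
    by (rule the_equality) (use endo_eigenvalue_iff [OF l [of 1, simplified]] in auto)
  then show ?thesis
    using endo_trace_eq [OF l] by simp
qed

text \<open>In a path-connected space all 0-simplices are homologous, so a constant simplex and its
  image under \<open>f\<close> represent the same generator. This trace is the source of the
  additional eigenvalue 1.\<close>

lemma endo_trace_rat_homology_0:
  assumes f: "continuous_map X X f" and X: "path_connected_space X" "topspace X \<noteq> {}"
  shows "endo_trace (rat_homology 0 X) (rat_hom_induced 0 X X f) = 1"
proof -
  obtain a where a: "a \<in> topspace X"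
    using X by blast
  define s where "s = restrict (\<lambda>x. a) (standard_simplex 0)"
  have s: "singular_simplex 0 X s"
    using a by (simp add: s_def singular_simplex_def)
  then have z: "singular_relcycle 0 X {} (frag_of s)"
    by (simp add: singular_cycle chain_boundary_def singular_chain_of)
  interpret rat_line "rat_homology 0 X" "rat_class 0 X (rat_of_frag (frag_of s))"
    using rat_line_homology [OF z] iso_integer_zeroth_homology_group [OF X(1) s] by simp
  have "homologous_rel 0 X {} (frag_of (simplex_map 0 f s)) (frag_of s)"
    using iso_integer_zeroth_homology_group_aux [OF X(1)] s f singular_simplex_simplex_map by blast
  then have "rat_of_frag (chain_map 0 f (frag_of s) - frag_of s) \<in> rat_boundaries 0 X"
    unfolding rat_of_frag_in_rat_boundaries homologous_rel_def by (intro exI [of _ 1]) simp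
  then have "rat_chain_map 0 f (rat_of_frag (frag_of s)) - rat_of_frag (frag_of s) \<in> rat_boundaries 0 X"
    by (simp add: rat_chain_map_rat_of_frag rat_of_frag_diff)
  from rat_boundaries_scale [OF this] 
  have "rat_hom_induced 0 X X f (q \<odot>\<^bsub>rat_homology 0 X\<^esub> rat_class 0 X (rat_of_frag (frag_of s))) =
     (1 * q) \<odot>\<^bsub>rat_homology 0 X\<^esub> rat_class 0 X (rat_of_frag (frag_of s))" for q
    by (simp add: smult_rat_homology rat_hom_induced_class [OF f] rat_class_eq_iff rat_chain_map_scale
       rat_scale_diff)
  then show ?thesis
    by (rule endo_trace_eq)
qed


subsection \<open>Power sums\<close>

lemma sum_mset_eq_sum_count:
  fixes f :: "'a \<Rightarrow> 'b::comm_semiring_1"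
  assumes "finite S" "set_mset A \<subseteq> S"
  shows "(\<Sum>x\<in>#A. f x) = (\<Sum>x\<in>S. of_nat (count A x) * f x)"
  using assms(2)
proof (induction A)
  case (add a A)
  have "(\<Sum>x\<in>S. of_nat (count (add_mset a A) x) * f x) =
      (\<Sum>x\<in>S. of_nat (count A x) * f x + (if x = a then f x else 0))"
    by (rule sum.cong) (auto simp: algebra_simps)
  also have "\<dots> = (\<Sum>x\<in>S. of_nat (count A x) * f x) + f a"
    using add.prems assms(1) by (simp add: sum.distrib)
  finally show ?case
    using add by (simp add: add.commute)
qed simp

text \<open>Let c(x) be the difference of the multiplicities of x. The hypothesis kills the sum of
  c(x) x p(x) for each monomial p, hence for each polynomial p. A polynomial that vanishes at all
  points but \<open>a\<close> isolates c(a) a. The extra factor x reflects the missing exponent 0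
  and is the reason to exclude the value 0; characteristic 0 turns c(a) = 0 into an equality of
  counts.\<close>

lemma mset_eq_iff_power_sums_eq:
  fixes A B :: "'a::field_char_0 multiset"
  assumes "0 \<notin># A" "0 \<notin># B"
  shows "(\<forall>m\<ge>1. (\<Sum>x\<in>#A. x ^ m) = (\<Sum>x\<in>#B. x ^ m)) \<longleftrightarrow> A = B"
proof
  assume eq: "\<forall>m\<ge>1. (\<Sum>x\<in>#A. x ^ m) = (\<Sum>x\<in>#B. x ^ m)"
  define S where "S = set_mset A \<union> set_mset B"
  have S: "finite S" "0 \<notin> S"
    using assms by (auto simp: S_def)
  define c where "c x = of_nat (count A x) - (of_nat (count B x) :: 'a)" for x
  have pow: "(\<Sum>x\<in>S. c x * x ^ Suc m) = 0" for m
    using eq [rule_format, of "Suc m"]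
      sum_mset_eq_sum_count [of S A "\<lambda>x. x ^ Suc m"] sum_mset_eq_sum_count [of S B "\<lambda>x. x ^ Suc m"]
    by (simp add: S_def c_def left_diff_distrib sum_subtractf)
  have poly: "(\<Sum>x\<in>S. c x * x * poly p x) = 0" for p
  proof -
    have "(\<Sum>x\<in>S. c x * x * poly p x) = (\<Sum>x\<in>S. \<Sum>i\<le>degree p. Polynomial.coeff p i * (c x * x ^ Suc i))"
      by (rule sum.cong) (simp_all add: poly_altdef sum_distrib_left mult_ac)
    also have "\<dots> = (\<Sum>i\<le>degree p. Polynomial.coeff p i * (\<Sum>x\<in>S. c x * x ^ Suc i))"
      by (subst sum.swap) (simp add: sum_distrib_left)
    finally show ?thesis
      by (simp only: pow mult_zero_right sum.neutral_const)
  qed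
  have "c a = 0" if a: "a \<in> S" for a
  proof -
    \<comment> \<open>Up to a nonzero constant, the Lagrange interpolation polynomial of the point
      \<open>a\<close>.\<close>
    let ?p = "\<Prod>y\<in>S - {a}. [:- y, 1:]"
    have "(\<Sum>x\<in>S. c x * x * poly ?p x) = (\<Sum>x\<in>{a}. c x * x * poly ?p x)"
      by (rule sum.mono_neutral_right) (use S a in \<open>auto simp: poly_prod\<close>)
    then have "c a * a * (\<Prod>y\<in>S - {a}. a - y) = 0"
      using poly [of ?p] by (simp add: poly_prod)
    then show ?thesis
      using S a by auto
  qed
  then have "count A x = count B x" for x
    by (cases "x \<in> S") (auto simp: c_def S_def not_in_iff)
  then show "A = B"
    by (rule multiset_eqI)
qed auto

lemma Lefschetz_formula:
  fixes X :: "'a topology"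
  assumes f: "continuous_map X X f" and X: "path_connected_space X" "topspace X \<noteq> {}"
    and "finite N" "0 \<notin> N"
    and cyclic: "\<And>p. p \<in> N \<Longrightarrow> homology_group (int p) X \<cong> integer_group"
    and trivial: "\<And>p. p \<notin> N \<Longrightarrow> p \<noteq> 0 \<Longrightarrow> trivial_group (homology_group (int p) X)"
  shows "lefschetz_number X (f ^^ m) = 1 + (\<Sum>p\<in>N. (-1) ^ p * hom_eigenvalue p X f ^ m)"
proof -
  have "continuous_map X X (f ^^ m)"
    by (rule continuous_map_funpow [OF f])
  then have tr0: "endo_trace (rat_homology 0 X) (rat_hom_induced 0 X X (f ^^ m)) = 1"
    using X by (rule endo_trace_rat_homology_0)
  have "lefschetz_number X (f ^^ m) =
      (\<Sum>p\<in>insert 0 N. (-1) ^ p * endo_trace (rat_homology p X) (rat_hom_induced p X X (f ^^ m)))"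
    unfolding lefschetz_number_def
  proof (rule Sum_any.expand_superset)
    show "{p. (-1) ^ p * endo_trace (rat_homology p X) (rat_hom_induced p X X (f ^^ m)) \<noteq> 0}
        \<subseteq> insert 0 N"
      using endo_trace_rat_homology_trivial [OF trivial] by auto
  qed (use \<open>finite N\<close> in simp)
  also have "\<dots> = 1 + (\<Sum>p\<in>N. (-1) ^ p * hom_eigenvalue p X f ^ m)"
    using assms(4,5) by (simp add: tr0 endo_trace_rat_homology_cyclic [OF f cyclic])
  finally show ?thesis .
qed

text \<open>Even degrees enter with sign +1 and odd ones with -1, and the leading 1 is the power sum
  of the single number 1. Zero values are dropped from both sides, since for
  \<open>m \<ge> 1\<close> they contribute nothing and power sums could not recover their
  multiplicity.\<close>

lemma Lefschetz_numbers_vanish_iff: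
  fixes n :: "'i \<Rightarrow> nat" and l :: "'i \<Rightarrow> rat"
  assumes I: "finite I"
  shows "(\<forall>m\<ge>1. 1 + (\<Sum>i\<in>I. (-1) ^ n i * l i ^ m) = 0) \<longleftrightarrow>
    image_mset l (mset_set {i \<in> {i \<in> I. odd (n i)}. l i \<noteq> 0}) =
    add_mset 1 (image_mset l (mset_set {i \<in> {i \<in> I. even (n i)}. l i \<noteq> 0}))"
    (is "_ \<longleftrightarrow> ?A = ?B")
proof -
  have "1 + (\<Sum>i\<in>I. (-1) ^ n i * l i ^ m) = 0 \<longleftrightarrow> (\<Sum>x\<in>#?A. x ^ m) = (\<Sum>x\<in>#?B. x ^ m)"
    if "m \<ge> 1" for m
  proof -
    have split: "(\<Sum>i | i \<in> I \<and> P (n i). l i ^ m) = (\<Sum>i | i \<in> I \<and> P (n i) \<and> l i \<noteq> 0. l i ^ m)" for P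
      by (rule sum.mono_neutral_right) (use that I in auto)
    have un: "{i \<in> I. even (n i)} \<union> {i \<in> I. odd (n i)} = I"
      by blast
    have "(\<Sum>i\<in>{i \<in> I. even (n i)} \<union> {i \<in> I. odd (n i)}. (-1) ^ n i * l i ^ m) =
       (\<Sum>i | i \<in> I \<and> even (n i). (-1) ^ n i * l i ^ m) + (\<Sum>i | i \<in> I \<and> odd (n i). (-1) ^ n i * l i ^ m)"
      by (rule sum.union_disjoint) (use I in auto)
    then have "(\<Sum>i\<in>I. (-1) ^ n i * l i ^ m) =
       (\<Sum>i | i \<in> I \<and> even (n i). (-1) ^ n i * l i ^ m) + (\<Sum>i | i \<in> I \<and> odd (n i). (-1) ^ n i * l i ^ m)"
      unfolding un .
    also have "(\<Sum>i | i \<in> I \<and> even (n i). (-1) ^ n i * l i ^ m) = (\<Sum>i | i \<in> I \<and> even (n i). l i ^ m)"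
      by (rule sum.cong) auto
    also have "(\<Sum>i | i \<in> I \<and> odd (n i). (-1) ^ n i * l i ^ m) = - (\<Sum>i | i \<in> I \<and> odd (n i). l i ^ m)"
      unfolding sum_negf [symmetric] by (rule sum.cong) auto
    finally have "(\<Sum>i\<in>I. (-1) ^ n i * l i ^ m) =
        (\<Sum>i | i \<in> I \<and> even (n i) \<and> l i \<noteq> 0. l i ^ m) - (\<Sum>i | i \<in> I \<and> odd (n i) \<and> l i \<noteq> 0. l i ^ m)"
      unfolding split [of even] split [of odd] by simp
    moreover have "(\<Sum>x\<in>#?A. x ^ m) = (\<Sum>i | i \<in> I \<and> odd (n i) \<and> l i \<noteq> 0. l i ^ m)"
      by (simp add: sum_unfold_sum_mset image_mset.compositionality o_def)
    moreover have "(\<Sum>x\<in>#?B. x ^ m) = 1 + (\<Sum>i | i \<in> I \<and> even (n i) \<and> l i \<noteq> 0. l i ^ m)"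
      by (simp add: sum_unfold_sum_mset image_mset.compositionality o_def)
    ultimately show ?thesis
      by linarith
  qed
  then have "(\<forall>m\<ge>1. 1 + (\<Sum>i\<in>I. (-1) ^ n i * l i ^ m) = 0) \<longleftrightarrow>
     (\<forall>m\<ge>1. (\<Sum>x\<in>#?A. x ^ m) = (\<Sum>x\<in>#?B. x ^ m))"
    by (intro all_cong1 imp_cong refl)
  also have "\<dots> \<longleftrightarrow> ?A = ?B"
  proof (rule mset_eq_iff_power_sums_eq)
    have "\<forall>x\<in>#?A. x \<noteq> 0" "\<forall>x\<in>#?B. x \<noteq> 0"
      using I by simp_all
    then show "0 \<notin># ?A" "0 \<notin># ?B"
      by blast+
  qed
  finally show ?thesis .
qed


subsection \<open>Disks\<close>

definition sqnorm :: "nat \<Rightarrow> (nat \<Rightarrow> real) \<Rightarrow> real" where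
  "sqnorm d u = (\<Sum>i<d. u i ^ 2)"

lemma sqnorm_nonneg [simp]: "0 \<le> sqnorm d u"
  by (simp add: sqnorm_def sum_nonneg)

lemma sqnorm_scale: "sqnorm d (\<lambda>i. c * u i) = c\<^sup>2 * sqnorm d u"
  by (simp add: sqnorm_def power_mult_distrib sum_distrib_left)

lemma sqnorm_zero [simp]: "sqnorm d (\<lambda>i. 0) = 0"
  by (simp add: sqnorm_def)

lemma disk_eq: "disk d = subtopology (powertop_real UNIV) {u. (\<forall>i\<ge>d. u i = 0) \<and> sqnorm d u \<le> 1}"
  by (simp add: disk_def Euclidean_space_def subtopology_subtopology sqnorm_def Collect_conj_eq)

lemma topspace_disk: "topspace (disk d) = {u. (\<forall>i\<ge>d. u i = 0) \<and> sqnorm d u \<le> 1}"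
  by (simp add: disk_eq)

lemma disk_boundary_eq:
  assumes "1 \<le> d"
  shows "disk_boundary d = subtopology (disk d) {u. sqnorm d u = 1}"
proof -
  have "{..d - 1} = {..<d}" "Suc (d - 1) = d"
    using assms by auto
  moreover have "{u. sqnorm d u \<le> 1} \<inter> {u. sqnorm d u = 1} = {u. sqnorm d u = 1}"
    by auto
  ultimately show ?thesis
    by (simp add: nsphere_def disk_def subtopology_subtopology flip: sqnorm_def)
qed

lemma topspace_disk_boundary:
  "1 \<le> d \<Longrightarrow> topspace (disk_boundary d) = {u \<in> topspace (disk d). sqnorm d u = 1}"
  by (simp only: disk_boundary_eq topspace_subtopology) auto

lemma disk_interior_eq: "disk_interior d = {u \<in> topspace (disk d). sqnorm d u < 1}"
  by (auto simp: disk_interior_def topspace_disk topspace_Euclidean_space sqnorm_def)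

lemma sqnorm_eq_0_iff:
  assumes "u \<in> topspace (disk d)"
  shows "sqnorm d u = 0 \<longleftrightarrow> u = (\<lambda>i. 0)"
proof
  assume "sqnorm d u = 0"
  then have "u i = 0" if "i < d" for i
    using that by (simp add: sqnorm_def sum_nonneg_eq_0_iff)
  moreover have "u i = 0" if "\<not> i < d" for i
    using that assms by (simp add: topspace_disk)
  ultimately show "u = (\<lambda>i. 0)"
    by blast
qed simp

lemma zero_in_disk [simp]: "(\<lambda>i. 0) \<in> topspace (disk d)"
  by (simp add: topspace_disk)

lemma continuous_map_disk_coordinate:
  "continuous_map Z (disk d) w \<Longrightarrow> continuous_map Z euclideanreal (\<lambda>z. w z i)"
  by (simp add: disk_eq continuous_map_in_subtopology continuous_map_componentwise_UNIV)

lemma continuous_map_sqnorm: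
  "continuous_map Z (disk d) w \<Longrightarrow> continuous_map Z euclideanreal (\<lambda>z. sqnorm d (w z))"
  unfolding sqnorm_def
  by (intro continuous_intros) (auto intro: continuous_map_disk_coordinate)

text \<open>The disk carries the product topology, so continuity is a matter of coordinates. Both
  the contraction of the open disk and the radial deformation have this form of a scalar times a
  vector.\<close>

lemma continuous_map_scaled_disk:
  assumes "continuous_map Z euclideanreal \<phi>" "continuous_map Z (disk d) w"
    and "\<And>z. z \<in> topspace Z \<Longrightarrow> (\<phi> z)\<^sup>2 * sqnorm d (w z) \<le> 1"
  shows "continuous_map Z (disk d) (\<lambda>z i. \<phi> z * w z i)"
proof -
  have "w z i = 0" if "z \<in> topspace Z" "d \<le> i" for z i
    using continuous_map_image_subset_topspace [OF assms(2)] that by (auto simp: topspace_disk)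
  moreover have "continuous_map Z euclideanreal (\<lambda>z. \<phi> z * w z i)" for i
    by (intro continuous_intros assms(1) continuous_map_disk_coordinate [OF assms(2)])
  ultimately show ?thesis
    using assms(3)
    by (auto simp: disk_eq continuous_map_in_subtopology continuous_map_componentwise_UNIV sqnorm_scale)
qed

text \<open>Points are infinite sequences, so the disk is exhibited as a closed subset of a product
  of infinitely many intervals [-1,1], which is compact by Tychonoff.\<close>

lemma compact_space_disk: "compact_space (disk d)"
proof -
  let ?C = "UNIV \<rightarrow>\<^sub>E {-1..1::real} :: (nat \<Rightarrow> real) set"
  have comp: "compactin (powertop_real UNIV) ?C"
    by (simp add: compactin_PiE)
  have "\<bar>u i\<bar> \<le> 1" if u: "u \<in> topspace (disk d)" for u i
  proof (cases "i < d")
    case True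
    then have "(u i)\<^sup>2 \<le> sqnorm d u"
      unfolding sqnorm_def by (intro member_le_sum) auto
    then have "(u i)\<^sup>2 \<le> 1"
      using u by (simp add: topspace_disk)
    then show ?thesis
      by (simp add: abs_square_le_1)
  qed (use u in \<open>auto simp: topspace_disk\<close>)
  then have "u i \<in> {-1..1}" if "u \<in> topspace (disk d)" for u i
    using that by (simp add: abs_le_iff minus_le_iff)
  then have sub: "topspace (disk d) \<subseteq> ?C"
    by (simp add: subset_iff PiE_UNIV_domain)
  have c: "continuous_on UNIV (\<lambda>u. u i)" for i :: nat
    by (simp add: continuous_on_product_coordinates)
  have "topspace (disk d) = (\<Inter>i\<in>{d..}. {u. u i = 0}) \<inter> {u. sqnorm d u \<le> 1}"
    by (auto simp: topspace_disk)
  moreover have "closed {u::nat \<Rightarrow> real. u i = 0}" for i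
    by (intro closed_Collect_eq c continuous_on_const)
  moreover have "closed {u. sqnorm d u \<le> 1}"
    unfolding sqnorm_def
    by (intro closed_Collect_le continuous_on_sum continuous_on_power c continuous_on_const)
  ultimately have "closed (topspace (disk d))"
    by (simp add: closed_INT closed_Int)
  then have "closedin (powertop_real UNIV) (topspace (disk d))"
    by (simp add: euclidean_product_topology)
  then have "compactin (powertop_real UNIV) (topspace (disk d))"
    by (rule closed_compactin [OF comp sub])
  then show ?thesis
    by (simp add: disk_eq topspace_disk compact_space_subtopology)
qed

text \<open>For \<open>t\<close> running from 0 to 1, each nonzero vector moves along its ray to norm \<open>c\<close>.\<close>

definition radial :: "nat \<Rightarrow> real \<Rightarrow> real \<times> (nat \<Rightarrow> real) \<Rightarrow> nat \<Rightarrow> real" where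
  "radial d c = (\<lambda>(t, u) i. (1 - t + t * c / sqrt (sqnorm d u)) * u i)"

lemma radial_0 [simp]: "radial d c (0, u) = u"
  by (simp add: radial_def)

lemma sqnorm_radial:
  assumes "0 < sqnorm d u"
  shows "sqnorm d (radial d c (t, u)) = ((1 - t) * sqrt (sqnorm d u) + t * c)\<^sup>2"
proof -
  let ?s = "sqrt (sqnorm d u)"
  have "sqnorm d (radial d c (t, u)) = ((1 - t + t * c / ?s) * ?s)\<^sup>2"
    by (simp add: radial_def sqnorm_scale power_mult_distrib)
  also have "(1 - t + t * c / ?s) * ?s = (1 - t) * ?s + t * c"
    using assms by (simp add: distrib_right)
  finally show ?thesis .
qed

lemma sqnorm_radial_pos:
  assumes "0 < sqnorm d u" "0 \<le> t" "t \<le> 1" "0 < c"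
  shows "0 < sqnorm d (radial d c (t, u))"
proof -
  have "0 < (1 - t) * sqrt (sqnorm d u) + t * c"
    using assms by (cases "t = 1") (auto intro!: add_pos_nonneg)
  then show ?thesis
    using assms by (simp add: sqnorm_radial)
qed

lemma sqnorm_radial_le:
  assumes "0 < sqnorm d u" "sqnorm d u \<le> 1" "0 \<le> t" "t \<le> 1" "0 \<le> c" "c \<le> 1"
  shows "sqnorm d (radial d c (t, u)) \<le> 1"
proof -
  have "(1 - t) * sqrt (sqnorm d u) + t * c \<le> (1 - t) * 1 + t * 1"
    using assms by (intro add_mono mult_left_mono) auto
  then show ?thesis
    using assms by (simp add: sqnorm_radial power_le_one)
qed

lemma sqnorm_radial_less:
  assumes "0 < sqnorm d u" "sqnorm d u < 1" "0 \<le> t" "t \<le> 1" "0 \<le> c" "c < 1"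
  shows "sqnorm d (radial d c (t, u)) < 1"
proof -
  have "(1 - t) * sqrt (sqnorm d u) + t * c < 1"
  \<comment> \<open>For \<open>t < 1\<close> the strictness comes from the norm of \<open>u\<close>,
    for \<open>t = 1\<close> from \<open>c\<close>.\<close>
  proof (cases "t = 1")
    case False
    then have "(1 - t) * sqrt (sqnorm d u) < (1 - t) * 1"
      using assms by (intro mult_strict_left_mono) auto
    moreover have "t * c \<le> t * 1"
      using assms by (intro mult_left_mono) auto
    ultimately show ?thesis
      by simp
  next
    case True
    then show ?thesis
      using assms by simp
  qed
  moreover have "0 \<le> (1 - t) * sqrt (sqnorm d u) + t * c"
    using assms by simp
  ultimately show ?thesis
    using power_strict_mono [of _ 1 2] assms(1) by (simp add: sqnorm_radial)
qed

text \<open>The unit sphere stays fixed when the target norm is 1; there the deformation of a cell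
  can be pasted with the identity on the rest of the space.\<close>

lemma radial_boundary:
  assumes "sqnorm d u = 1"
  shows "radial d 1 (t, u) = u"
  using assms by (simp add: radial_def)

text \<open>The parameter space is arbitrary so that both the homotopy and its end map, with \<tau>
  constantly 1, are instances. Positivity keeps the denominator nonzero.\<close>

lemma continuous_map_radial:
  assumes \<tau>: "continuous_map Z (top_of_set {0..1}) \<tau>" and w: "continuous_map Z (disk d) w"
    and pos: "\<And>z. z \<in> topspace Z \<Longrightarrow> 0 < sqnorm d (w z)"
    and c: "0 \<le> c" "c \<le> 1"
  shows "continuous_map Z (disk d) (\<lambda>z. radial d c (\<tau> z, w z))"
  unfolding radial_def case_prod_conv
proof (rule continuous_map_scaled_disk [OF _ w])
  have \<tau>': "continuous_map Z euclideanreal \<tau>"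
    using \<tau> by (simp add: continuous_map_in_subtopology)
  show "continuous_map Z euclideanreal (\<lambda>z. 1 - \<tau> z + \<tau> z * c / sqrt (sqnorm d (w z)))"
  proof (intro continuous_map_add continuous_map_diff continuous_map_real_mult continuous_map_real_divide
      continuous_map_canonical_const \<tau>')
    show "continuous_map Z euclideanreal (\<lambda>z. sqrt (sqnorm d (w z)))"
      using continuous_map_compose [OF continuous_map_sqnorm [OF w], of euclidean sqrt]
      by (simp add: o_def continuous_on_real_sqrt continuous_on_id)
  qed (use pos in force)
  fix z
  assume z: "z \<in> topspace Z"
  then have "w z \<in> topspace (disk d)" "\<tau> z \<in> {0..1}"
    using \<tau> w by (auto simp: continuous_map_def Pi_iff)
  then have "sqnorm d (radial d c (\<tau> z, w z)) \<le> 1"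
    using pos [OF z] c by (intro sqnorm_radial_le) (auto simp: topspace_disk)
  then show "(1 - \<tau> z + \<tau> z * c / sqrt (sqnorm d (w z)))\<^sup>2 * sqnorm d (w z) \<le> 1"
    by (simp add: radial_def sqnorm_scale)
qed

section \<open>Homotopy type of the open disk and of the punctured open disk\<close>

lemma contractible_disk_interior: "contractible_space (subtopology (disk d) (disk_interior d))"
proof -
  let ?B = "subtopology (disk d) (disk_interior d)"
  let ?H = "\<lambda>z::real \<times> (nat \<Rightarrow> real). \<lambda>i. (1 - fst z) * snd z i"
  let ?Z = "prod_topology (top_of_set {0..1::real}) ?B"
  have snd: "continuous_map ?Z (disk d) snd"
    using continuous_map_snd continuous_map_into_fulltopology by blast
  have fst: "continuous_map ?Z euclideanreal fst"
    using continuous_map_fst continuous_map_into_fulltopology by blast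
  have bound: "(1 - t)\<^sup>2 * sqnorm d u \<le> sqnorm d u" if "t \<in> {0..1}" for t u
    using that by (intro mult_left_le_one_le) (auto intro: power_le_one)
  have "continuous_map ?Z (disk d) ?H"
  proof (rule continuous_map_scaled_disk [OF _ snd])
    show "continuous_map ?Z euclideanreal (\<lambda>x. 1 - fst x)"
      by (intro continuous_intros fst)
    show "(1 - fst z)\<^sup>2 * sqnorm d (snd z) \<le> 1" if "z \<in> topspace ?Z" for z
      using that bound [of "fst z" "snd z"] by (auto simp: topspace_disk)
  qed
  moreover have "?H z \<in> disk_interior d" if "z \<in> topspace ?Z" for z
    using that bound [of "fst z" "snd z"] by (auto simp: disk_interior_eq topspace_disk sqnorm_scale)
  ultimately have "continuous_map ?Z ?B ?H"
    by (intro continuous_map_into_subtopology) auto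
  then have "homotopic_with (\<lambda>_. True) ?B ?B id (\<lambda>_ i. 0)"
    by (subst homotopic_with) (auto intro!: exI [of _ ?H])
  then show ?thesis
    unfolding contractible_space_def by blast
qed

text \<open>The unit sphere does not lie in the open disk, so it is put there with radius 1/2, and
  normalization is its homotopy inverse. One composite is the identity of the sphere; the other is
  the end of the radial deformation to norm 1/2.\<close>

lemma reduced_homology_punctured_disk_interior:
  assumes "1 \<le> d"
  shows "reduced_homology_group p (subtopology (disk d) (disk_interior d - {\<lambda>i. 0}))
     \<cong> reduced_homology_group p (disk_boundary d)"
proof -
  let ?B = "subtopology (disk d) (disk_interior d - {\<lambda>i. 0})"
  let ?Z = "prod_topology (top_of_set {0..1::real}) ?B"
  have tB: "topspace ?B = {u \<in> topspace (disk d). 0 < sqnorm d u \<and> sqnorm d u < 1}"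
  proof -
    have "u \<noteq> (\<lambda>i. 0) \<longleftrightarrow> 0 < sqnorm d u" if "u \<in> topspace (disk d)" for u
      using sqnorm_eq_0_iff [OF that] sqnorm_nonneg [of d u] by linarith
    then show ?thesis
      by (auto simp: disk_interior_eq)
  qed
  have snd: "continuous_map ?Z (disk d) snd"
    using continuous_map_snd continuous_map_into_fulltopology by blast
  have to_sphere: "continuous_map ?B (disk_boundary d) (\<lambda>u. radial d 1 (1, u))"
    unfolding disk_boundary_eq [OF assms]
  proof (rule continuous_map_into_subtopology)
    show "continuous_map ?B (disk d) (\<lambda>u. radial d 1 (1, u))"
      by (rule continuous_map_radial) (auto simp: tB simp del: topspace_subtopology)
  qed (auto simp: tB sqnorm_radial simp del: topspace_subtopology)
  have to_half: "continuous_map (disk_boundary d) ?B (\<lambda>u. radial d (1/2) (1, u))"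
    unfolding disk_boundary_eq [OF assms]
  proof (rule continuous_map_into_subtopology)
    show "continuous_map (subtopology (disk d) {u. sqnorm d u = 1}) (disk d) (\<lambda>u. radial d (1/2) (1, u))"
      by (rule continuous_map_radial) auto
    then have "radial d (1/2) (1, u) \<in> topspace ?B" if "u \<in> topspace (disk d)" "sqnorm d u = 1" for u
      using that sqnorm_radial [of d u "1/2" 1] unfolding tB
      by (simp add: continuous_map_def Pi_iff power2_eq_square)
    then show "(\<lambda>u. radial d (1/2) (1, u)) \<in> topspace (subtopology (disk d) {u. sqnorm d u = 1}) \<rightarrow> disk_interior d - {\<lambda>i. 0}"
      by simp
  qed
  have cont: "continuous_map ?Z (disk d) (radial d (1/2))"
    using continuous_map_radial [OF continuous_map_fst snd, of "1/2"]
    by (auto simp: tB simp del: topspace_subtopology)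
  have "radial d (1/2) z \<in> topspace ?B" if "z \<in> topspace ?Z" for z
  proof -
    have "fst z \<in> {0..1}" "snd z \<in> topspace ?B"
      using that unfolding topspace_prod_topology by (simp_all add: mem_Times_iff)
    moreover have "radial d (1/2) z \<in> topspace (disk d)"
      using continuous_map_image_subset_topspace [OF cont] that by blast
    ultimately show ?thesis
      using sqnorm_radial_pos [of d "snd z" "fst z" "1/2"] sqnorm_radial_less [of d "snd z" "fst z" "1/2"]
      unfolding tB by simp
  qed
  then have "continuous_map ?Z ?B (radial d (1/2))"
    by (intro continuous_map_into_subtopology [OF cont]) auto
  then have hom: "homotopic_with (\<lambda>_. True) ?B ?B id (\<lambda>u. radial d (1/2) (1, u))"
    by (subst homotopic_with) (auto intro!: exI [of _ "radial d (1/2)"])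
  have "((\<lambda>u. radial d (1/2) (1, u)) \<circ> (\<lambda>u. radial d 1 (1, u))) u = radial d (1/2) (1, u)"
    if "u \<in> topspace ?B" for u
    using that sqnorm_radial [of d u 1 1] unfolding tB by (simp add: radial_def mult.commute)
  then have 1: "homotopic_with (\<lambda>_. True) ?B ?B ((\<lambda>u. radial d (1/2) (1, u)) \<circ> (\<lambda>u. radial d 1 (1, u))) id"
    by (intro homotopic_with_eq [OF homotopic_with_symD [OF hom]]) auto
  have "radial d 1 (1, radial d (1/2) (1, u)) = u" if "u \<in> topspace (disk_boundary d)" for u
  proof -
    have u: "sqnorm d u = 1"
      using that unfolding topspace_disk_boundary [OF assms] by simp
    then have "sqrt (sqnorm d (radial d (1/2) (1, u))) = 1/2"
      by (subst sqnorm_radial) simp_all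
    then have "radial d 1 (1, radial d (1/2) (1, u)) = (\<lambda>i. radial d (1/2) (1, u) i / (1/2))"
      by (simp only: radial_def [of d 1] case_prod_conv) (simp add: mult.commute)
    then show ?thesis
      using u by (simp add: radial_def)
  qed
  then have 2: "homotopic_with (\<lambda>_. True) (disk_boundary d) (disk_boundary d)
      ((\<lambda>u. radial d 1 (1, u)) \<circ> (\<lambda>u. radial d (1/2) (1, u))) id"
    using continuous_map_compose [OF to_half to_sphere] by (intro homotopic_with_equal) auto
  show ?thesis
    by (rule homotopy_equivalent_space_imp_isomorphic_reduced_homology_groups)
      (use to_sphere to_half 1 2 in \<open>unfold homotopy_equivalent_space_def, blast\<close>)
qed

lemma continuous_map_cases_closedin:
  assumes "closedin X C" "closedin X D" "topspace X = C \<union> D"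
    and "continuous_map (subtopology X C) Y f" "continuous_map (subtopology X D) Y g"
    and "\<And>x. x \<in> C \<inter> D \<Longrightarrow> f x = g x"
  shows "continuous_map X Y (\<lambda>x. if x \<in> C then f x else g x)"
  by (rule pasting_lemma_closed [where I = "UNIV::bool set" and T = "\<lambda>b. if b then C else D"
        and f = "\<lambda>b. if b then f else g"])
    (use assms in \<open>auto split: if_splits\<close>)


subsection \<open>Homology of a space with a cell attached\<close>

text \<open>An internal view of the glued space: a closed part \<open>P\<close> and a disk that
  meets it exactly in its boundary. The map \<open>h\<close> is injective on the whole closed disk
  because the attaching maps considered are embeddings.\<close>

locale cell_attachment =
  fixes X :: "'a topology" and P :: "'a set" and d :: nat and h :: "(nat \<Rightarrow> real) \<Rightarrow> 'a"
  assumes dim: "1 \<le> d"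
    and Hausdorff: "Hausdorff_space X"
    and closed: "closedin X P"
    and cont: "continuous_map (disk d) X h"
    and inj: "inj_on h (topspace (disk d))"
    and cover: "topspace X = P \<union> h ` topspace (disk d)"
    and boundary: "\<And>u. u \<in> topspace (disk d) \<Longrightarrow> h u \<in> P \<longleftrightarrow> sqnorm d u = 1"

definition (in cell_attachment) center :: 'a where
  "center = h (\<lambda>i. 0)"

definition (in cell_attachment) chart :: "'a \<Rightarrow> nat \<Rightarrow> real" where
  "chart = inv_into (topspace (disk d)) h"

text \<open>The radial deformation transported to the cell and extended by the identity. It leaves
  the center in place and moves all other points of the open cell towards the attaching sphere, so
  it is used only off the center.\<close>

definition (in cell_attachment) push :: "real \<times> 'a \<Rightarrow> 'a" where
  "push = (\<lambda>(t, x). if x \<in> P then x else h (radial d 1 (t, chart x)))"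

section \<open>Pushing the punctured space onto the old part\<close>

lemma (in cell_attachment) chart_h [simp]: "u \<in> topspace (disk d) \<Longrightarrow> chart (h u) = u"
  by (simp add: chart_def inj)

lemma (in cell_attachment) closed_map_h: "closed_map (disk d) X h"
  using cont compact_space_disk Hausdorff by (rule continuous_imp_closed_map)

lemma (in cell_attachment) homeomorphic_map_h:
  "homeomorphic_map (disk d) (subtopology X (h ` topspace (disk d))) h"
  using injective_closed_imp_embedding_map [OF cont closed_map_h inj] by (simp add: embedding_map_def)

lemma (in cell_attachment) continuous_map_chart:
  "continuous_map (subtopology X (h ` topspace (disk d))) (disk d) chart"
proof -
  obtain k where k: "homeomorphic_maps (disk d) (subtopology X (h ` topspace (disk d))) h k"
    using homeomorphic_map_h homeomorphic_map_maps by blast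
  then have cont_k: "continuous_map (subtopology X (h ` topspace (disk d))) (disk d) k"
    and kh: "\<And>u. u \<in> topspace (disk d) \<Longrightarrow> k (h u) = u"
    unfolding homeomorphic_maps_def by blast+
  show ?thesis
  proof (rule continuous_map_eq [OF cont_k])
    fix x
    assume "x \<in> topspace (subtopology X (h ` topspace (disk d)))"
    then obtain u where "u \<in> topspace (disk d)" "x = h u"
      by auto
    then show "k x = chart x"
      by (simp add: kh)
  qed
qed

lemma (in cell_attachment) h_in_topspace: "u \<in> topspace (disk d) \<Longrightarrow> h u \<in> topspace X"
  using cover by blast

lemma (in cell_attachment) center_notin: "center \<notin> P"
  by (simp add: center_def boundary)

lemma (in cell_attachment) h_eq_center_iff:
  "u \<in> topspace (disk d) \<Longrightarrow> h u = center \<longleftrightarrow> sqnorm d u = 0"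
  using inj by (simp add: center_def sqnorm_eq_0_iff inj_on_eq_iff)

lemma (in cell_attachment) sqnorm_chart_pos:
  "x \<in> h ` topspace (disk d) \<Longrightarrow> x \<noteq> center \<Longrightarrow> 0 < sqnorm d (chart x)"
  using h_eq_center_iff by (auto simp: less_le)

lemma (in cell_attachment) openin_minus_center: "openin X (topspace X - {center})"
proof -
  have "center \<in> topspace X"
    unfolding center_def by (simp add: h_in_topspace)
  then have "closedin X {center}"
    using Hausdorff by (simp add: closedin_Hausdorff_singleton)
  then show ?thesis
    by (simp add: openin_diff)
qed

lemma (in cell_attachment) topspace_minus_P: "topspace X - P = h ` disk_interior d"
  using cover boundary by (force simp: disk_interior_eq topspace_disk)

text \<open>Two closed sets cover the domain, the preimages of \<open>P\<close> and of the closed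
  cell. They overlap where the chart has norm 1, and there the deformation stands still, so the two
  formulas agree.\<close>

lemma (in cell_attachment) continuous_map_push:
  "continuous_map (prod_topology (top_of_set {0..1}) (subtopology X (topspace X - {center})))
     (subtopology X (topspace X - {center})) push"
proof -
  let ?U = "topspace X - {center}"
  let ?Z = "prod_topology (top_of_set {0..1::real}) (subtopology X ?U)"
  let ?Q = "h ` topspace (disk d)"
  have snd: "continuous_map ?Z X snd"
    using continuous_map_snd continuous_map_into_fulltopology by blast
  have Q: "closedin X ?Q"
    using closed_map_h by (simp add: closed_map_def)
  let ?C = "{z \<in> topspace ?Z. snd z \<in> P}" and ?D = "{z \<in> topspace ?Z. snd z \<in> ?Q}"
  let ?g = "\<lambda>z. h (radial d 1 (fst z, chart (snd z)))"
  let ?ZD = "subtopology ?Z ?D"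
  have fstD: "continuous_map ?ZD (top_of_set {0..1}) fst"
    by (rule continuous_map_from_subtopology [OF continuous_map_fst])
  have sndD: "continuous_map ?ZD (subtopology X ?Q) snd"
    by (rule continuous_map_into_subtopology [OF continuous_map_from_subtopology [OF snd]]) auto
  have "continuous_map ?ZD (disk d) (\<lambda>z. radial d 1 (fst z, chart (snd z)))"
  proof (rule continuous_map_radial [OF fstD])
    show "continuous_map ?ZD (disk d) (\<lambda>z. chart (snd z))"
      using continuous_map_compose [OF sndD continuous_map_chart] by (simp add: o_def)
    show "0 < sqnorm d (chart (snd z))" if "z \<in> topspace ?ZD" for z
      using that by (intro sqnorm_chart_pos) (auto simp: mem_Times_iff)
  qed auto
  then have g: "continuous_map ?ZD X ?g"
    using continuous_map_compose [OF _ cont] by (fastforce simp: o_def)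
  have "continuous_map ?Z X (\<lambda>z. if z \<in> ?C then snd z else ?g z)"
  proof (rule continuous_map_cases_closedin [OF _ _ _ _ g])
    show "closedin ?Z ?C" "closedin ?Z ?D"
      using closedin_continuous_map_preimage [OF snd] closed Q by blast+
    show "topspace ?Z = ?C \<union> ?D"
      using cover by (auto simp: mem_Times_iff)
    show "continuous_map (subtopology ?Z ?C) X snd"
      by (rule continuous_map_from_subtopology [OF snd])
    show "snd z = ?g z" if "z \<in> ?C \<inter> ?D" for z
      using that boundary by (auto simp: radial_boundary)
  qed
  then have cont: "continuous_map ?Z X push"
    by (rule continuous_map_eq) (auto simp: push_def)
  have "push z \<noteq> center" if "z \<in> topspace ?Z" for z
  proof (cases "snd z \<in> P")
    case True
    then show ?thesis
      using center_notin by (auto simp: push_def case_prod_unfold)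
  next
    case False
    moreover have "snd z \<in> topspace X"
      using continuous_map_image_subset_topspace [OF snd] that by blast
    ultimately obtain u where u: "u \<in> topspace (disk d)" "snd z = h u"
      using cover by auto
    then have pos: "0 < sqnorm d u" "fst z \<in> {0..1}"
      using that h_eq_center_iff [OF u(1)] by (auto simp: mem_Times_iff less_le)
    let ?v = "radial d 1 (fst z, u)"
    have "0 < sqnorm d ?v"
      using pos by (intro sqnorm_radial_pos) auto
    moreover have "?v \<in> topspace (disk d)"
      using u pos sqnorm_radial_le [of d u "fst z" 1] by (simp add: topspace_disk) (simp add: radial_def)
    ultimately have "h ?v \<noteq> center"
      using h_eq_center_iff by simp
    then show ?thesis
      using False u by (simp add: push_def case_prod_unfold)
  qed
  moreover have "push z \<in> topspace X" if "z \<in> topspace ?Z" for z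
    using continuous_map_image_subset_topspace [OF cont] that by blast
  ultimately show ?thesis
    by (intro continuous_map_into_subtopology [OF cont]) blast
qed

lemma (in cell_attachment) push_0: "x \<in> topspace X \<Longrightarrow> push (0, x) = x"
  using cover by (auto simp: push_def)

lemma (in cell_attachment) push_P: "x \<in> P \<Longrightarrow> push (t, x) = x"
  by (simp add: push_def)

text \<open>The end point lies on the attaching sphere and not merely somewhere in \<open>P\<close>.
  This is what allows the punctured cell to be pushed into a prescribed subspace
  \<open>T\<close>.\<close>

lemma (in cell_attachment) push_1:
  assumes "x \<in> topspace X" "x \<noteq> center" "x \<notin> P"
  obtains v where "v \<in> topspace (disk_boundary d)" "push (1, x) = h v"
proof -
  obtain u where u: "u \<in> topspace (disk d)" "x = h u"
    using assms cover by auto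
  then have pos: "0 < sqnorm d u"
    using assms h_eq_center_iff [OF u(1)] by (auto simp: less_le)
  let ?v = "radial d 1 (1, u)"
  have "sqnorm d ?v = 1"
    using pos by (simp add: sqnorm_radial)
  moreover have "\<forall>i\<ge>d. ?v i = 0"
    using u by (simp add: radial_def topspace_disk)
  ultimately have "?v \<in> topspace (disk_boundary d)"
    by (simp only: topspace_disk_boundary [OF dim] topspace_disk) simp
  moreover have "push (1, x) = h ?v"
    using u assms by (simp add: push_def)
  ultimately show thesis
    by (rule that)
qed

lemma (in cell_attachment) homotopic_push:
  "homotopic_with (\<lambda>_. True) (subtopology X (topspace X - {center}))
     (subtopology X (topspace X - {center})) id (\<lambda>x. push (1, x))"
  by (subst homotopic_with) (use continuous_map_push push_0 in \<open>auto intro!: exI [of _ push]\<close>)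

lemma (in cell_attachment) continuous_map_push_1:
  "continuous_map (subtopology X (topspace X - {center})) (subtopology X (topspace X - {center})) (\<lambda>x. push (1, x))"
  using homotopic_push homotopic_with_imp_continuous_maps by blast

lemma (in cell_attachment) P_subset: "P \<subseteq> topspace X - {center}"
  using closed center_notin closedin_subset by fastforce

lemma (in cell_attachment) push_1_in_P:
  assumes "x \<in> topspace X" "x \<noteq> center"
  shows "push (1, x) \<in> P"
proof (cases "x \<in> P")
  case False
  with assms obtain v where "v \<in> topspace (disk_boundary d)" "push (1, x) = h v"
    by (rule push_1)
  then show ?thesis
    using boundary unfolding topspace_disk_boundary [OF dim] by simp
qed (simp add: push_P)

text \<open>The push is a deformation retraction, with the inclusion as homotopy inverse.\<close>

lemma (in cell_attachment) homotopy_equivalent_P: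
  "subtopology X (topspace X - {center}) homotopy_equivalent_space subtopology X P"
  unfolding homotopy_equivalent_space_def
proof (intro exI conjI)
  let ?U = "subtopology X (topspace X - {center})"
  have X: "continuous_map ?U X (\<lambda>x. push (1, x))"
    using continuous_map_push_1 continuous_map_into_fulltopology by blast
  show "continuous_map ?U (subtopology X P) (\<lambda>x. push (1, x))"
    by (rule continuous_map_into_subtopology [OF X]) (auto intro: push_1_in_P)
  show "continuous_map (subtopology X P) ?U id"
    using P_subset by (auto intro!: continuous_map_into_subtopology)
  show "homotopic_with (\<lambda>_. True) ?U ?U (id \<circ> (\<lambda>x. push (1, x))) id"
    using homotopic_with_symD [OF homotopic_push] by simp
  show "homotopic_with (\<lambda>_. True) (subtopology X P) (subtopology X P) ((\<lambda>x. push (1, x)) \<circ> id) id"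
    by (rule homotopic_with_symD, rule homotopic_with_equal) (auto simp: push_P)
qed

section \<open>The open cell and the punctured cell as subspaces\<close>

lemma (in cell_attachment) homeomorphic_subspace:
  assumes "S \<subseteq> topspace (disk d)"
  shows "subtopology (disk d) S homeomorphic_space subtopology X (h ` S)"
proof -
  have S: "topspace X \<inter> h ` topspace (disk d) \<inter> h ` S = h ` S"
    using assms cover by auto
  have "homeomorphic_map (subtopology (disk d) S) (subtopology (subtopology X (h ` topspace (disk d))) (h ` S)) h"
    by (rule homeomorphic_map_subtopologies [OF homeomorphic_map_h])
      (use assms S in \<open>auto simp: Int_absorb1\<close>)
  moreover have "subtopology (subtopology X (h ` topspace (disk d))) (h ` S) = subtopology X (h ` S)"
    using assms by (simp add: subtopology_subtopology Int_absorb1 image_mono)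
  ultimately show ?thesis
    using homeomorphic_map_imp_homeomorphic_space by metis
qed

lemma (in cell_attachment) contractible_cell:
  "contractible_space (subtopology X (topspace X - P))"
proof -
  have "disk_interior d \<subseteq> topspace (disk d)"
    by (auto simp: disk_interior_eq)
  then show ?thesis
    using contractible_disk_interior homeomorphic_space_contractibility homeomorphic_subspace
    unfolding topspace_minus_P by blast
qed

lemma (in cell_attachment) punctured_cell_eq:
  "topspace X - {center} - P = h ` (disk_interior d - {\<lambda>i. 0})"
proof -
  have "topspace X - {center} - P = h ` disk_interior d - {center}"
    using topspace_minus_P by blast
  also have "\<dots> = h ` disk_interior d - h ` {\<lambda>i. 0}"
    by (simp add: center_def)
  also have "\<dots> = h ` (disk_interior d - {\<lambda>i. 0})"
    by (rule inj_on_image_set_diff [OF inj, symmetric]) (auto simp: disk_interior_eq)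
  finally show ?thesis .
qed

lemma (in cell_attachment) reduced_homology_punctured_cell:
  "reduced_homology_group p (subtopology X (topspace X - {center} - P))
     \<cong> reduced_homology_group p (disk_boundary d)"
proof -
  have "subtopology (disk d) (disk_interior d - {\<lambda>i. 0})
      homeomorphic_space subtopology X (topspace X - {center} - P)"
    unfolding punctured_cell_eq by (rule homeomorphic_subspace) (auto simp: disk_interior_eq)
  then have "subtopology X (topspace X - {center} - P)
      homeomorphic_space subtopology (disk d) (disk_interior d - {\<lambda>i. 0})"
    by (rule homeomorphic_space_sym [THEN iffD1])
  then have "reduced_homology_group p (subtopology X (topspace X - {center} - P)) \<cong>
      reduced_homology_group p (subtopology (disk d) (disk_interior d - {\<lambda>i. 0}))"
    by (rule homeomorphic_space_imp_isomorphic_reduced_homology_groups)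
  then show ?thesis
    using reduced_homology_punctured_disk_interior [OF dim] by (rule iso_trans)
qed

text \<open>Here the center pays off: \<open>P\<close> is closed and its neighbourhood, the
  complement of the center, is open, as excision demands. What remains is the pair of the open cell
  and the punctured cell.\<close>

lemma (in cell_attachment) excision:
  "hom_induced p (subtopology X (topspace X - P)) (topspace X - {center} - P) X (topspace X - {center}) id
     \<in> iso (relative_homology_group p (subtopology X (topspace X - P)) (topspace X - {center} - P))
           (relative_homology_group p X (topspace X - {center}))"
proof -
  have "X closure_of P \<subseteq> X interior_of (topspace X - {center})"
    using closed openin_minus_center P_subset by (simp add: closure_of_closedin interior_of_openin)
  from homology_excision_axiom [OF this, of "topspace X" p] show ?thesis
    by simp
qed

lemma (in cell_attachment) boundary_iso_cell:
  "hom_boundary p (subtopology X (topspace X - P)) (topspace X - {center} - P)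
     \<in> iso (relative_homology_group p (subtopology X (topspace X - P)) (topspace X - {center} - P))
           (reduced_homology_group (p - 1) (subtopology X (topspace X - {center} - P)))"
proof -
  \<comment> \<open>Any nonzero vector of norm below 1 would do; coordinate 0 exists since
    \<open>d \<ge> 1\<close>. The connecting map of a pair with contractible total space is an
    isomorphism onto reduced homology when the subspace is nonempty.\<close>
  have "(\<lambda>i. if i = 0 then 1/2 else 0) \<in> disk_interior d - {\<lambda>i. 0}"
  proof -
    let ?u = "\<lambda>i. if i = 0 then 1/2 else 0 :: real"
    have "sqnorm d ?u = 1/4"
      using dim by (simp add: sqnorm_def power2_eq_square if_distrib [where f = "\<lambda>x. x * _"] cong: if_cong)
    moreover have "?u \<noteq> (\<lambda>i. 0)"
      by (metis half_gt_zero less_irrefl zero_less_one)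
    ultimately show ?thesis
      using dim by (simp add: disk_interior_eq topspace_disk)
  qed
  then have "topspace X - {center} - P \<noteq> {}"
    unfolding punctured_cell_eq by blast
  moreover have "topspace (subtopology X (topspace X - P)) \<inter> (topspace X - {center} - P) = topspace X - {center} - P"
    unfolding topspace_subtopology by blast
  ultimately have ne: "topspace (subtopology X (topspace X - P)) \<inter> (topspace X - {center} - P) \<noteq> {}"
    by (simp only: not_False_eq_True)
  have eq: "(topspace X - P) \<inter> (topspace X - {center} - P) = topspace X - {center} - P"
    by blast
  show ?thesis
    using iso_relative_homology_of_contractible [OF contractible_cell ne, of p]
    unfolding subtopology_subtopology eq .
qed

lemma (in cell_attachment) relative_homology_cell:
  "relative_homology_group p X (topspace X - {center}) \<cong> reduced_homology_group (p - 1) (disk_boundary d)"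
proof -
  have "relative_homology_group p X (topspace X - {center}) \<cong>
      relative_homology_group p (subtopology X (topspace X - P)) (topspace X - {center} - P)"
    using excision group.iso_sym is_isoI group_relative_homology_group by blast
  also have "\<dots> \<cong> reduced_homology_group (p - 1) (subtopology X (topspace X - {center} - P))"
    using boundary_iso_cell is_isoI by blast
  also have "\<dots> \<cong> reduced_homology_group (p - 1) (disk_boundary d)"
    by (rule reduced_homology_punctured_cell)
  finally show ?thesis .
qed

text \<open>The punctured cell has reduced homology only in degree \<open>d - 1\<close>. In that
  degree the inclusion is homotopic to the end of the push, which factors through \<open>T\<close>,
  and \<open>T\<close> has no reduced homology there.\<close>

lemma (in cell_attachment) inclusion_punctured_cell_trivial:
  assumes T: "h ` topspace (disk_boundary d) \<subseteq> T" "T \<subseteq> P"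
    and triv: "trivial_group (reduced_homology_group (int d - 1) (subtopology X T))"
    and c: "c \<in> carrier (reduced_homology_group p (subtopology X (topspace X - {center} - P)))"
  shows "hom_induced p (subtopology X (topspace X - {center} - P)) {} (subtopology X (topspace X - {center})) {} id c
     = \<one>\<^bsub>reduced_homology_group p (subtopology X (topspace X - {center}))\<^esub>"
proof -
  let ?W = "subtopology X (topspace X - {center} - P)"
  let ?U = "subtopology X (topspace X - {center})"
  let ?T = "subtopology X T"
  have one: "hom_induced p Y {} Z {} g c' = \<one>\<^bsub>reduced_homology_group p Z\<^esub>"
    if "trivial_group (reduced_homology_group p Y)" "c' \<in> carrier (reduced_homology_group p Y)"
    for Y Z :: "'a topology" and g c'
  proof -
    have "c' = \<one>\<^bsub>reduced_homology_group p Y\<^esub>"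
      using that by (simp add: trivial_group_def)
    then show ?thesis
      using hom_one [OF hom_induced_reduced_hom [of p Y Z g]] by simp
  qed
  show ?thesis
  proof (cases "p = int d - 1")
    case False
    then have "p \<noteq> int (d - 1)"
      using dim by auto
    then have "trivial_group (reduced_homology_group p ?W)"
      using isomorphic_group_triviality [OF reduced_homology_punctured_cell]
      by (simp add: reduced_homology_group_nsphere(2))
    then show ?thesis
      using c by (rule one)
  next
    case True
    have incl: "continuous_map ?W ?U id"
      by (auto intro!: continuous_map_into_subtopology)
    have push: "continuous_map ?W ?U (\<lambda>x. push (1, x))"
      using continuous_map_compose [OF incl continuous_map_push_1] by (simp add: o_def)
    have "push (1, x) \<in> T" if "x \<in> topspace ?W" for x
    proof -
      from that have "x \<in> topspace X" "x \<noteq> center" "x \<notin> P"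
        by auto
      then obtain v where "v \<in> topspace (disk_boundary d)" "push (1, x) = h v"
        by (rule push_1)
      then show ?thesis
        using T by auto
    qed
    then have 1: "continuous_map ?W ?T (\<lambda>x. push (1, x))"
      by (intro continuous_map_into_subtopology [OF continuous_map_into_fulltopology [OF push]]) auto
    have 2: "continuous_map ?T ?U id"
      using P_subset T by (auto intro!: continuous_map_into_subtopology)
    have "homotopic_with (\<lambda>_. True) ?W ?U (id \<circ> id) ((\<lambda>x. push (1, x)) \<circ> id)"
      by (rule homotopic_with_compose_continuous_map_right [OF homotopic_push incl]) simp
    then have "hom_induced p ?W {} ?U {} id c = hom_induced p ?W {} ?U {} (id \<circ> (\<lambda>x. push (1, x))) c"
      using homology_homotopy_empty by (fastforce simp: o_def id_def)
    also have "\<dots> = hom_induced p ?T {} ?U {} id (hom_induced p ?W {} ?T {} (\<lambda>x. push (1, x)) c)"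
      using hom_induced_compose_empty [OF 1 2] by simp
    also have "\<dots> = \<one>\<^bsub>reduced_homology_group p ?U\<^esub>"
      by (rule one) (use triv True hom_induced_reduced [OF c] in auto)
    finally show ?thesis .
  qed
qed

text \<open>By excision every relative class comes from the pair of the cell and the punctured cell.
  Naturality then makes its boundary the image of a class of the punctured cell, and such images are
  trivial.\<close>

lemma (in cell_attachment) hom_boundary_trivial:
  assumes T: "h ` topspace (disk_boundary d) \<subseteq> T" "T \<subseteq> P"
    and triv: "trivial_group (reduced_homology_group (int d - 1) (subtopology X T))"
    and c: "c \<in> carrier (relative_homology_group p X (topspace X - {center}))"
  shows "hom_boundary p X (topspace X - {center}) c
     = \<one>\<^bsub>reduced_homology_group (p - 1) (subtopology X (topspace X - {center}))\<^esub>"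
proof -
  let ?U = "topspace X - {center}" and ?V = "subtopology X (topspace X - P)"
  have eq: "subtopology ?V (?U - P) = subtopology X (?U - P)"
  proof -
    have "(topspace X - P) \<inter> (?U - P) = ?U - P"
      by blast
    then show ?thesis
      by (simp only: subtopology_subtopology)
  qed
  have "c \<in> hom_induced p ?V (?U - P) X ?U id ` carrier (relative_homology_group p ?V (?U - P))"
    using excision [of p] c by (simp add: iso_def bij_betw_def)
  then obtain b where b: "c = hom_induced p ?V (?U - P) X ?U id b"
    "b \<in> carrier (relative_homology_group p ?V (?U - P))"
    by (rule imageE)
  have "continuous_map ?V X id" "id \<in> ?U - P \<rightarrow> ?U"
    by (auto simp: continuous_map_from_subtopology)
  from naturality_hom_induced [OF this, of p]
  have "hom_boundary p X ?U c = hom_induced (p - 1) (subtopology X (?U - P)) {} (subtopology X ?U) {} id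
      (hom_boundary p ?V (?U - P) b)"
    unfolding b(1) eq by (simp only: fun_eq_iff comp_apply)
  also have "\<dots> = \<one>\<^bsub>reduced_homology_group (p - 1) (subtopology X ?U)\<^esub>"
    using hom_in_carrier [OF iso_imp_homomorphism [OF boundary_iso_cell] b(2)]
    by (rule inclusion_punctured_cell_trivial [OF T triv])
  finally show ?thesis .
qed

section \<open>The exact sequence of the pair\<close>

lemma exact_seq_image_eq_kernel:
  "exact_seq ([G, K, H], [g, h]) \<Longrightarrow> h ` carrier H = kernel K G g"
  by simp

lemma exact_seq_imp_group_hom_last: "exact_seq ([G, K, H], [g, h]) \<Longrightarrow> group_hom K G g"
  by (simp add: group_hom_def group_hom_axioms_def)

lemma (in cell_attachment) punctured_nonempty: "topspace X \<inter> (topspace X - {center}) \<noteq> {}"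
proof -
  obtain v where v: "v \<in> topspace (disk_boundary d)"
    using in_topspace_nsphere by blast
  then have "v \<in> topspace (disk d)" "sqnorm d v = 1"
    unfolding topspace_disk_boundary [OF dim] by blast+
  then have "h v \<in> P"
    by (simp add: boundary)
  then show ?thesis
    using P_subset by blast
qed

text \<open>By exactness the kernel is the image of the connecting map from degree
  \<open>p + 1\<close>, and that map is trivial.\<close>

lemma (in cell_attachment) inj_on_inclusion:
  assumes T: "h ` topspace (disk_boundary d) \<subseteq> T" "T \<subseteq> P"
    and triv: "trivial_group (reduced_homology_group (int d - 1) (subtopology X T))"
  shows "inj_on (hom_induced p (subtopology X (topspace X - {center})) {} X {} id)
    (carrier (reduced_homology_group p (subtopology X (topspace X - {center}))))"
proof -
  let ?U = "topspace X - {center}"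
  let ?i = "hom_induced p (subtopology X ?U) {} X {} id"
  interpret group_hom "reduced_homology_group p (subtopology X ?U)" "reduced_homology_group p X" ?i
    by (simp add: group_hom_def group_hom_axioms_def hom_induced_reduced_hom)
  have "p + 1 - 1 = p"
    by simp
  note ex = exact_seq_image_eq_kernel [OF homology_exactness_reduced_2 [of "p + 1" X ?U, unfolded this]]
  have "kernel (reduced_homology_group p (subtopology X ?U)) (reduced_homology_group p X) ?i
      \<subseteq> {\<one>\<^bsub>reduced_homology_group p (subtopology X ?U)\<^esub>}"
    unfolding ex [symmetric]
    using hom_boundary_trivial [OF T triv, of _ "p + 1"] by (simp only: image_subset_iff singleton_iff) simp
  then have "kernel (reduced_homology_group p (subtopology X ?U)) (reduced_homology_group p X) ?i
      = {\<one>\<^bsub>reduced_homology_group p (subtopology X ?U)\<^esub>}"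
    using subgroup.one_closed [OF subgroup_kernel] by blast
  then show ?thesis
    by (simp only: inj_iff_trivial_ker)
qed

lemma (in cell_attachment) reduced_homology_punctured:
  "reduced_homology_group p (subtopology X (topspace X - {center})) \<cong> reduced_homology_group p (subtopology X P)"
  by (rule homotopy_equivalent_space_imp_isomorphic_reduced_homology_groups [OF homotopy_equivalent_P])

text \<open>Away from degree \<open>d\<close> the relative group vanishes, so the injective
  inclusion map is also surjective.\<close>

lemma (in cell_attachment) reduced_homology_other_dim:
  assumes T: "h ` topspace (disk_boundary d) \<subseteq> T" "T \<subseteq> P"
    and triv: "trivial_group (reduced_homology_group (int d - 1) (subtopology X T))"
    and p: "p \<noteq> int d"
  shows "reduced_homology_group p X \<cong> reduced_homology_group p (subtopology X P)"
proof -
  let ?U = "topspace X - {center}"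
  let ?i = "hom_induced p (subtopology X ?U) {} X {} id"
  let ?j = "hom_induced p X {} X ?U id"
  note ex3 = homology_exactness_reduced_3 [of p X ?U]
  have "p - 1 \<noteq> int (d - 1)"
    using p dim by auto
  then have triv_rel: "trivial_group (relative_homology_group p X ?U)"
    using isomorphic_group_triviality [OF relative_homology_cell [of p]] by (simp add: reduced_homology_group_nsphere(2))
  have "?i ` carrier (reduced_homology_group p (subtopology X ?U))
      = kernel (reduced_homology_group p X) (relative_homology_group p X ?U) ?j"
    by (rule exact_seq_image_eq_kernel [OF ex3])
  also have "\<dots> = carrier (reduced_homology_group p X)"
    by (rule group_hom.kernel_to_trivial_group [OF exact_seq_imp_group_hom_last [OF ex3] triv_rel])
  finally have "?i \<in> iso (reduced_homology_group p (subtopology X ?U)) (reduced_homology_group p X)"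
    using inj_on_inclusion [OF T triv] hom_induced_reduced_hom by (simp add: iso_def bij_betw_def)
  then have "reduced_homology_group p (subtopology X ?U) \<cong> reduced_homology_group p X"
    by (rule is_isoI)
  then have "reduced_homology_group p X \<cong> reduced_homology_group p (subtopology X ?U)"
    by (rule group.iso_sym [OF group_reduced_homology_group])
  then show ?thesis
    using reduced_homology_punctured by (rule iso_trans)
qed

text \<open>The absolute group maps isomorphically to the relative one: injectively because the old
  part has nothing in degree \<open>d\<close>, surjectively because the connecting map is trivial.
  The assumption on \<open>P\<close> is where distinct dimensions enter.\<close>

lemma (in cell_attachment) reduced_homology_dim:
  assumes T: "h ` topspace (disk_boundary d) \<subseteq> T" "T \<subseteq> P"
    and triv: "trivial_group (reduced_homology_group (int d - 1) (subtopology X T))"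
    and P: "trivial_group (reduced_homology_group (int d) (subtopology X P))"
  shows "reduced_homology_group (int d) X \<cong> integer_group"
proof -
  let ?U = "topspace X - {center}" and ?p = "int d"
  let ?i = "hom_induced ?p (subtopology X ?U) {} X {} id"
  let ?j = "hom_induced ?p X {} X ?U id"
  note ex1 = homology_exactness_reduced_1 [OF punctured_nonempty, of ?p]
  note ex3 = homology_exactness_reduced_3 [of ?p X ?U]
  interpret j: group_hom "reduced_homology_group ?p X" "relative_homology_group ?p X ?U" ?j
    using ex3 by (rule exact_seq_imp_group_hom_last)
  interpret i: group_hom "reduced_homology_group ?p (subtopology X ?U)" "reduced_homology_group ?p X" ?i
    by (simp add: group_hom_def group_hom_axioms_def hom_induced_reduced_hom)
  have "trivial_group (reduced_homology_group ?p (subtopology X ?U))"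
    using P isomorphic_group_triviality [OF reduced_homology_punctured] by simp
  then have "?i ` carrier (reduced_homology_group ?p (subtopology X ?U)) = {\<one>\<^bsub>reduced_homology_group ?p X\<^esub>}"
    by (rule i.image_from_trivial_group)
  then have "kernel (reduced_homology_group ?p X) (relative_homology_group ?p X ?U) ?j =
      {\<one>\<^bsub>reduced_homology_group ?p X\<^esub>}"
    unfolding exact_seq_image_eq_kernel [OF ex3] .
  then have inj: "inj_on ?j (carrier (reduced_homology_group ?p X))"
    by (simp only: j.inj_iff_trivial_ker)
  have "?j ` carrier (reduced_homology_group ?p X) =
      kernel (relative_homology_group ?p X ?U) (reduced_homology_group (?p - 1) (subtopology X ?U)) (hom_boundary ?p X ?U)"
    by (rule exact_seq_image_eq_kernel [OF ex1])
  also have "\<dots> = carrier (relative_homology_group ?p X ?U)"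
    using hom_boundary_trivial [OF T triv, of _ ?p] unfolding kernel_def by blast
  finally have "?j \<in> iso (reduced_homology_group ?p X) (relative_homology_group ?p X ?U)"
    using inj j.homh by (simp add: iso_def bij_betw_def)
  then have "reduced_homology_group ?p X \<cong> relative_homology_group ?p X ?U"
    by (rule is_isoI)
  also have "\<dots> \<cong> reduced_homology_group (?p - 1) (disk_boundary d)"
    by (rule relative_homology_cell)
  also have "?p - 1 = int (d - 1)"
    using dim by simp
  also have "reduced_homology_group (int (d - 1)) (disk_boundary d) \<cong> integer_group"
    by (rule reduced_homology_group_nsphere(1))
  finally show ?thesis .
qed


subsection \<open>Homology of bubble spaces\<close>

locale cell_pushout =
  fixes X Y :: "'a topology" and d :: nat and g i h
  assumes dim: "1 \<le> d"
    and Hausdorff: "Hausdorff_space X"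
    and embedding: "embedding_map (disk_boundary d) Y g"
    and pushout: "is_pushout (disk_boundary d) (disk d) g Y X i h"

section \<open>The topology of the pushout and its closed subspaces\<close>

lemma (in cell_pushout)
  shows topspace_X: "topspace X = i ` topspace Y \<union> h ` topspace (disk d)"
    and inj_i: "inj_on i (topspace Y)"
    and h_eq_i: "\<forall>u \<in> topspace (disk d). \<forall>y \<in> topspace Y.
      h u = i y \<longleftrightarrow> u \<in> topspace (disk_boundary d) \<and> g u = y"
    and h_eq_h: "\<forall>u \<in> topspace (disk d). \<forall>v \<in> topspace (disk d).
      h u = h v \<longleftrightarrow> u = v \<or> u \<in> topspace (disk_boundary d) \<and> v \<in> topspace (disk_boundary d) \<and> g u = g v"
    and openin_X: "\<forall>U. U \<subseteq> topspace X \<longrightarrow> (openin X U \<longleftrightarrow>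
      openin Y {y \<in> topspace Y. i y \<in> U} \<and> openin (disk d) {u \<in> topspace (disk d). h u \<in> U})"
proof -
  note po = pushout [unfolded is_pushout_def]
  note po2 = po [THEN conjunct2] and po3 = po [THEN conjunct2, THEN conjunct2]
  note po4 = po3 [THEN conjunct2]
  show "topspace X = i ` topspace Y \<union> h ` topspace (disk d)"
    by (rule po [THEN conjunct1])
  show "inj_on i (topspace Y)"
    by (rule po2 [THEN conjunct1])
  show "\<forall>u \<in> topspace (disk d). \<forall>y \<in> topspace Y.
      h u = i y \<longleftrightarrow> u \<in> topspace (disk_boundary d) \<and> g u = y"
    by (rule po3 [THEN conjunct1])
  show "\<forall>u \<in> topspace (disk d). \<forall>v \<in> topspace (disk d).
      h u = h v \<longleftrightarrow> u = v \<or> u \<in> topspace (disk_boundary d) \<and> v \<in> topspace (disk_boundary d) \<and> g u = g v"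
    by (rule po4 [THEN conjunct1])
  show "\<forall>U. U \<subseteq> topspace X \<longrightarrow> (openin X U \<longleftrightarrow>
      openin Y {y \<in> topspace Y. i y \<in> U} \<and> openin (disk d) {u \<in> topspace (disk d). h u \<in> U})"
    by (rule po4 [THEN conjunct2])
qed

lemma (in cell_pushout) h_eq_i_iff:
  "u \<in> topspace (disk d) \<Longrightarrow> y \<in> topspace Y \<Longrightarrow> h u = i y \<longleftrightarrow> u \<in> topspace (disk_boundary d) \<and> g u = y"
  by (rule h_eq_i [THEN bspec, THEN bspec])

lemma (in cell_pushout) openin_iff:
  "U \<subseteq> topspace X \<Longrightarrow> openin X U \<longleftrightarrow>
     openin Y {y \<in> topspace Y. i y \<in> U} \<and> openin (disk d) {u \<in> topspace (disk d). h u \<in> U}"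
  by (rule openin_X [THEN spec, THEN mp])

lemma (in cell_pushout) closedin_iff:
  assumes "C \<subseteq> topspace X"
  shows "closedin X C \<longleftrightarrow>
     closedin Y {y \<in> topspace Y. i y \<in> C} \<and> closedin (disk d) {u \<in> topspace (disk d). h u \<in> C}"
proof -
  have "{y \<in> topspace Y. i y \<in> topspace X - C} = topspace Y - {y \<in> topspace Y. i y \<in> C}"
    "{u \<in> topspace (disk d). h u \<in> topspace X - C} = topspace (disk d) - {u \<in> topspace (disk d). h u \<in> C}"
    using topspace_X by blast+
  then show ?thesis
    using assms openin_iff [of "topspace X - C"] by (simp add: closedin_def)
qed

lemma (in cell_pushout) continuous_map_g: "continuous_map (disk_boundary d) Y g"
  using embedding unfolding embedding_map_def
  by (rule continuous_map_into_fulltopology [OF homeomorphic_imp_continuous_map])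

lemma (in cell_pushout) g_in_topspace: "u \<in> topspace (disk_boundary d) \<Longrightarrow> g u \<in> topspace Y"
  using continuous_map_image_subset_topspace [OF continuous_map_g] by blast

lemma (in cell_pushout) inj_g: "inj_on g (topspace (disk_boundary d))"
  using embedding by (simp add: embedding_map_def homeomorphic_map_def)

lemma (in cell_pushout) boundary_subset: "topspace (disk_boundary d) \<subseteq> topspace (disk d)"
  unfolding topspace_disk_boundary [OF dim] by blast

lemma (in cell_pushout) h_boundary: "u \<in> topspace (disk_boundary d) \<Longrightarrow> h u = i (g u)"
  using h_eq_i_iff g_in_topspace boundary_subset by blast

lemma closedin_disk_boundary:
  assumes "1 \<le> d"
  shows "closedin (disk d) (topspace (disk_boundary d))"
proof -
  have "continuous_map (disk d) euclideanreal (sqnorm d)"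
    using continuous_map_sqnorm [of "disk d" d id] by simp
  from closedin_continuous_map_preimage [OF this, of "{1}"] show ?thesis
    unfolding topspace_disk_boundary [OF assms] by simp
qed

lemma (in cell_pushout) continuous_map_i: "continuous_map Y X i"
  unfolding continuous_map_def using topspace_X openin_iff [OF openin_subset] by auto

lemma (in cell_pushout) continuous_map_h: "continuous_map (disk d) X h"
  unfolding continuous_map_def using topspace_X openin_iff [OF openin_subset] by auto

lemma (in cell_pushout) closed_map_i: "closed_map Y X i"
  unfolding closed_map_def
proof (intro allI impI)
  fix C
  assume C: "closedin Y C"
  then have sub: "C \<subseteq> topspace Y"
    by (rule closedin_subset)
  have "{y \<in> topspace Y. i y \<in> i ` C} = C"
    using sub inj_i by (auto simp: inj_on_def)
  moreover have "{u \<in> topspace (disk d). h u \<in> i ` C} = {u \<in> topspace (disk_boundary d). g u \<in> C}"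
    using sub h_eq_i_iff boundary_subset h_boundary by blast
  moreover have "closedin (disk d) {u \<in> topspace (disk_boundary d). g u \<in> C}"
  proof -
    have eq: "disk_boundary d = subtopology (disk d) (topspace (disk_boundary d))"
      unfolding disk_boundary_eq [OF dim] by (simp add: subtopology_subtopology subtopology_restrict)
    have "closedin (disk_boundary d) {u \<in> topspace (disk_boundary d). g u \<in> C}"
      by (rule closedin_continuous_map_preimage [OF continuous_map_g C])
    then show ?thesis
      using closedin_trans_full closedin_disk_boundary [OF dim] eq by metis
  qed
  moreover have "i ` C \<subseteq> topspace X"
    using sub topspace_X by blast
  ultimately show "closedin X (i ` C)"
    using C by (simp only: closedin_iff)
qed

lemma (in cell_pushout) embedding_map_i: "embedding_map Y X i"
  using continuous_map_i closed_map_i inj_i by (rule injective_closed_imp_embedding_map)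

lemma (in cell_pushout) homeomorphic_image_subspace:
  assumes "T \<subseteq> topspace Y"
  shows "subtopology X (i ` T) homeomorphic_space subtopology Y T"
proof -
  have eq: "subtopology (subtopology X (i ` topspace Y)) (i ` T) = subtopology X (i ` T)"
    using assms by (simp add: subtopology_subtopology Int_absorb1 image_mono)
  have "homeomorphic_map Y (subtopology X (i ` topspace Y)) i"
    using embedding_map_i by (simp add: embedding_map_def)
  moreover have "i ` (topspace Y \<inter> T) = topspace (subtopology X (i ` topspace Y)) \<inter> i ` T"
    using assms topspace_X by auto
  ultimately have "homeomorphic_map (subtopology Y T) (subtopology X (i ` T)) i"
    unfolding eq [symmetric] by (rule homeomorphic_map_subtopologies)
  then show ?thesis
    using homeomorphic_map_imp_homeomorphic_space homeomorphic_space_sym by blast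
qed

text \<open>The Hausdorff property is known for the final space and descends to the earlier stages,
  which embed into it. In the induction over the gluing process it is therefore a premise, not a
  conclusion.\<close>

lemma (in cell_pushout) Hausdorff_space_Y: "Hausdorff_space Y"
proof -
  have "subtopology X (i ` topspace Y) homeomorphic_space Y"
    using homeomorphic_image_subspace [of "topspace Y"] by simp
  then show ?thesis
    using Hausdorff Hausdorff_space_subtopology homeomorphic_Hausdorff_space by blast
qed

text \<open>The pushout identifies two points of the disk only if \<open>g\<close> does, and
  \<open>g\<close> is injective; so the closed disk is embedded.\<close>

lemma (in cell_pushout) cell_attachment: "cell_attachment X (i ` topspace Y) d h"
proof
  show "closedin X (i ` topspace Y)"
    using closed_map_i by (simp add: closed_map_def)
  show "inj_on h (topspace (disk d))"
  proof (rule inj_onI)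
    fix u v
    assume uv: "u \<in> topspace (disk d)" "v \<in> topspace (disk d)" "h u = h v"
    then have "u = v \<or> u \<in> topspace (disk_boundary d) \<and> v \<in> topspace (disk_boundary d) \<and> g u = g v"
      by (rule h_eq_h [THEN bspec, THEN bspec, THEN iffD1])
    then show "u = v"
      using inj_on_eq_iff [OF inj_g] by blast
  qed
  show "h u \<in> i ` topspace Y \<longleftrightarrow> sqnorm d u = 1" if "u \<in> topspace (disk d)" for u
  proof -
    have "h u \<in> i ` topspace Y \<longleftrightarrow> u \<in> topspace (disk_boundary d)"
      using that h_eq_i_iff g_in_topspace by blast
    then show ?thesis
      using that unfolding topspace_disk_boundary [OF dim] by simp
  qed
qed (use dim Hausdorff continuous_map_h topspace_X in auto)

text \<open>A disk of dimension at most \<open>e\<close> is attached inside a subspace \<open>T\<close> without reduced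
  homology below degree \<open>e\<close>, so the attaching map is zero on reduced homology.\<close>

definition homology_pieces :: "'a topology \<Rightarrow> (nat \<times> 'a set) list \<Rightarrow> bool" where
  "homology_pieces X ps \<longleftrightarrow> (\<forall>e R. (e, R) \<in> set ps \<longrightarrow> (\<exists>T. R \<subseteq> T \<and> T \<subseteq> topspace X \<and>
     (\<forall>p<int e. trivial_group (reduced_homology_group p (subtopology X T)))))"

definition homology_in_dims :: "'a topology \<Rightarrow> nat set \<Rightarrow> bool" where
  "homology_in_dims X N \<longleftrightarrow> (\<forall>p\<in>N. reduced_homology_group (int p) X \<cong> integer_group) \<and>
     (\<forall>p. p \<notin> int ` N \<longrightarrow> trivial_group (reduced_homology_group p X))"

lemma homology_pieces_sphere:
  assumes "X homeomorphic_space nsphere n"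
  shows "homology_pieces X [(n, topspace X)]"
  using isomorphic_group_triviality [OF homeomorphic_space_imp_isomorphic_reduced_homology_groups [OF assms]]
  by (auto simp: homology_pieces_def reduced_homology_group_nsphere(2) intro!: exI [of _ "topspace X"])

lemma homology_in_dims_sphere:
  assumes "X homeomorphic_space nsphere n"
  shows "homology_in_dims X {n}"
proof -
  note iso = homeomorphic_space_imp_isomorphic_reduced_homology_groups [OF assms]
  have "reduced_homology_group (int n) X \<cong> integer_group"
    using iso reduced_homology_group_nsphere(1) by (rule iso_trans)
  moreover have "trivial_group (reduced_homology_group p X)" if "p \<noteq> int n" for p
    using isomorphic_group_triviality [OF iso] reduced_homology_group_nsphere(2) [OF that] by simp
  ultimately show ?thesis
    by (simp add: homology_in_dims_def)
qed

text \<open>Gluing only shrinks an old piece, so its subspace \<open>T\<close>, carried along by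
  \<open>i\<close>, still serves. The new open cell is contractible and can be its own
  \<open>T\<close>.\<close>

lemma (in cell_pushout) homology_pieces_glue:
  assumes ps: "homology_pieces Y ps" and qs: "\<And>e S. (e, S) \<in> set qs \<Longrightarrow> \<exists>R. (e, R) \<in> set ps \<and> S \<subseteq> R"
  shows "homology_pieces X (map (\<lambda>(k, S). (k, i ` S)) qs @ [(d, h ` disk_interior d)])"
  unfolding homology_pieces_def
proof (intro allI impI)
  interpret cell_attachment X "i ` topspace Y" d h
    by (rule cell_attachment)
  fix e R'
  assume "(e, R') \<in> set (map (\<lambda>(k, S). (k, i ` S)) qs @ [(d, h ` disk_interior d)])"
  then have "(e, R') = (d, h ` disk_interior d) \<or> (\<exists>x\<in>set qs. (e, R') = (fst x, i ` snd x))"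
    by (simp add: case_prod_unfold image_iff)
  then consider S where "(e, S) \<in> set qs" "R' = i ` S" | "R' = h ` disk_interior d"
  proof (elim disjE bexE)
    assume "(e, R') = (d, h ` disk_interior d)"
    then show thesis
      by (intro that(2)) simp
  next
    fix x
    assume "x \<in> set qs" "(e, R') = (fst x, i ` snd x)"
    then show thesis
      by (intro that(1) [of "snd x"]) simp_all
  qed
  then show "\<exists>T. R' \<subseteq> T \<and> T \<subseteq> topspace X \<and>
     (\<forall>p<int e. trivial_group (reduced_homology_group p (subtopology X T)))"
  proof cases
    case 1
    obtain R where R: "(e, R) \<in> set ps" "S \<subseteq> R"
      using qs [OF 1(1)] by (elim exE conjE)
    obtain T where T: "R \<subseteq> T" "T \<subseteq> topspace Y"
      "\<forall>p<int e. trivial_group (reduced_homology_group p (subtopology Y T))"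
      using ps [unfolded homology_pieces_def, THEN spec, THEN spec, THEN mp, OF R(1)] by (elim exE conjE)
    have "trivial_group (reduced_homology_group p (subtopology X (i ` T)))" if "p < int e" for p
      using T(3) that isomorphic_group_triviality
        [OF homeomorphic_space_imp_isomorphic_reduced_homology_groups [OF homeomorphic_image_subspace [OF T(2)]]]
      by simp
    moreover have "R' \<subseteq> i ` T"
      unfolding 1(2) by (rule image_mono [OF order_trans [OF R(2) T(1)]])
    moreover have "i ` T \<subseteq> topspace X"
      unfolding topspace_X by (rule le_supI1 [OF image_mono [OF T(2)]])
    ultimately show ?thesis
      by (intro exI [of _ "i ` T"] conjI allI impI)
  next
    case 2
    have "trivial_group (reduced_homology_group p (subtopology X R'))" for p
      using trivial_reduced_homology_group_contractible_space [OF contractible_cell]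
      unfolding topspace_minus_P 2 .
    moreover have "R' \<subseteq> topspace X"
      unfolding 2 topspace_minus_P [symmetric] by (rule Diff_subset)
    ultimately show ?thesis
      by (intro exI [of _ R']) simp
  qed
qed

lemma (in cell_pushout) homology_in_dims_glue:
  assumes Y: "homology_in_dims Y N" and "d \<notin> N"
    and T: "g ` topspace (disk_boundary d) \<subseteq> T" "T \<subseteq> topspace Y"
    and triv: "trivial_group (reduced_homology_group (int d - 1) (subtopology Y T))"
  shows "homology_in_dims X (insert d N)"
proof -
  interpret cell_attachment X "i ` topspace Y" d h
    by (rule cell_attachment)
  have T': "h ` topspace (disk_boundary d) \<subseteq> i ` T" "i ` T \<subseteq> i ` topspace Y"
    using T h_boundary by auto
  have triv': "trivial_group (reduced_homology_group (int d - 1) (subtopology X (i ` T)))"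
    using triv isomorphic_group_triviality
      [OF homeomorphic_space_imp_isomorphic_reduced_homology_groups [OF homeomorphic_image_subspace [OF T(2)]]]
    by simp
  have "subtopology X (i ` topspace Y) homeomorphic_space Y"
    using homeomorphic_image_subspace [of "topspace Y"] by simp
  note XY = homeomorphic_space_imp_isomorphic_reduced_homology_groups [OF this]
  have Y1: "reduced_homology_group (int p) Y \<cong> integer_group" if "p \<in> N" for p
    using Y that by (simp add: homology_in_dims_def)
  have Y2: "trivial_group (reduced_homology_group p Y)" if "p \<notin> int ` N" for p
    using Y that by (simp add: homology_in_dims_def)
  have "int d \<notin> int ` N"
    using \<open>d \<notin> N\<close> by (simp add: image_iff)
  then have "trivial_group (reduced_homology_group (int d) (subtopology X (i ` topspace Y)))"
    using Y2 isomorphic_group_triviality [OF XY] by simp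
  then have eq: "reduced_homology_group (int d) X \<cong> integer_group"
    by (rule reduced_homology_dim [OF T' triv'])
  have ne: "reduced_homology_group p X \<cong> reduced_homology_group p Y" if "p \<noteq> int d" for p
    using reduced_homology_other_dim [OF T' triv' that] XY by (rule iso_trans)
  have "reduced_homology_group (int p) X \<cong> integer_group" if "p \<in> insert d N" for p
  proof (cases "p = d")
    case False
    then show ?thesis
      using that by (intro iso_trans [OF ne Y1]) auto
  qed (simp add: eq)
  moreover have "trivial_group (reduced_homology_group p X)" if "p \<notin> int ` insert d N" for p
    using that isomorphic_group_triviality [OF ne [of p]] Y2 [of p] by simp
  ultimately show ?thesis
    by (simp add: homology_in_dims_def)
qed

text \<open>The statement on pieces holds for all dimensions and the one on homology only for
  distinct ones, so distinctness guards just that conjunct. That no dimension is 0 and that the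
  space is nonempty will give path-connectedness.\<close>

lemma bubble_homology:
  assumes "bubble X ps" "Hausdorff_space X"
  shows "homology_pieces X ps \<and> (distinct (map fst ps) \<longrightarrow> homology_in_dims X (set (map fst ps))) \<and>
    0 \<notin> set (map fst ps) \<and> ps \<noteq> [] \<and> topspace X \<noteq> {}"
  using assms
proof (induction rule: bubble.induct)
  case (sphere n X)
  have "topspace X \<noteq> {}"
    using sphere.hyps(2) homeomorphic_empty_space_eq nonempty_nsphere null_topspace_iff_trivial by metis
  then show ?case
    using sphere.hyps by (simp add: homology_pieces_sphere homology_in_dims_sphere)
next
  case (glue Y ps j e R d g X i h)
  interpret cell_pushout X Y d g i h
    by standard (fact glue.hyps glue.prems)+
  have IH1: "homology_pieces Y ps"
    and IH2: "distinct (map fst ps) \<Longrightarrow> homology_in_dims Y (set (map fst ps))"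
    and IH3: "0 \<notin> set (map fst ps)"
    using glue.IH [OF Hausdorff_space_Y] by simp_all
  let ?R = "R - g ` topspace (disk_boundary d)"
  let ?qs = "ps[j := (e, ?R)]"
  let ?rs = "map (\<lambda>(k, S). (k, i ` S)) ?qs @ [(d, h ` disk_interior d)]"
  have mem: "(e, R) \<in> set ps"
    using nth_mem [OF glue.hyps(2)] unfolding glue.hyps(3) .
  have "\<exists>R'. (k, R') \<in> set ps \<and> S \<subseteq> R'" if "(k, S) \<in> set ?qs" for k S
  proof -
    have "(k, S) \<in> insert (e, ?R) (set ps)"
      using set_update_subset_insert that by (rule subsetD)
    then show ?thesis
      using mem by blast
  qed
  then have pieces: "homology_pieces X ?rs"
    using homology_pieces_glue [OF IH1] by simp
  \<comment> \<open>Gluing alters only the free part of the piece \<open>j\<close>, so the list of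
    dimensions merely gains \<open>d\<close>.\<close>
  have "map fst (map (\<lambda>(k, S). (k, i ` S)) ?qs) = map fst ?qs"
    by (simp add: case_prod_unfold)
  also have "\<dots> = (map fst ps)[j := map fst ps ! j]"
    using glue.hyps(2,3) by (simp add: map_update)
  finally have dims: "map fst ?rs = map fst ps @ [d]"
    by simp
  obtain T where T: "R \<subseteq> T" "T \<subseteq> topspace Y"
    "\<forall>p<int e. trivial_group (reduced_homology_group p (subtopology Y T))"
    using IH1 mem unfolding homology_pieces_def by blast
  \<comment> \<open>The gluing condition \<open>d \<le> e\<close> is used here: it puts degree
    \<open>d - 1\<close> below \<open>e\<close>.\<close>
  have triv: "trivial_group (reduced_homology_group (int d - 1) (subtopology Y T))"
    using T(3) glue.hyps(5) by simp
  have gT: "g ` topspace (disk_boundary d) \<subseteq> T"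
    using T(1) glue.hyps(7) by blast
  have "homology_in_dims X (set (map fst ps @ [d]))" if "distinct (map fst ps @ [d])"
    using homology_in_dims_glue [OF IH2 _ gT T(2) triv] that by simp
  moreover have "0 \<notin> set (map fst ps @ [d])"
    using IH3 glue.hyps(4) by simp
  moreover have "topspace X \<noteq> {}"
    using topspace_X zero_in_disk by blast
  ultimately show ?case
    unfolding dims using pieces by simp
qed

text \<open>Reduced homology in degree 0 is the kernel of the map to the homology of a point. If it
  is trivial this map is injective; any point of \<open>X\<close> is a section of the constant map
  and makes it surjective. Having the zeroth homology of a point means path-connectedness.\<close>

lemma homology_in_dims_path_connected:
  assumes "homology_in_dims X N" "0 \<notin> N" "topspace X \<noteq> {}"
  shows "path_connected_space X"
proof -
  let ?pt = "discrete_topology {()}"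
  let ?h = "hom_induced 0 X {} ?pt {} (\<lambda>x. ())"
  interpret group_hom "homology_group 0 X" "homology_group 0 ?pt" ?h
    by (simp add: group_hom_def group_hom_axioms_def hom_induced_empty_hom)
  have "trivial_group (reduced_homology_group 0 X)"
  proof -
    have "(0::int) \<notin> int ` N"
      using assms(2) by (simp add: image_iff)
    then show ?thesis
      using assms(1) unfolding homology_in_dims_def by blast
  qed
  then have "kernel (homology_group 0 X) (homology_group 0 ?pt) ?h = {\<one>\<^bsub>homology_group 0 X\<^esub>}"
    by (simp only: carrier_reduced_homology_group [symmetric] trivial_group_def one_reduced_homology_group)
  then have inj: "inj_on ?h (carrier (homology_group 0 X))"
    by (simp only: inj_iff_trivial_ker)
  obtain a where a: "a \<in> topspace X"
    using assms(3) by blast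
  then have "retraction_map X ?pt (\<lambda>x. ())"
    unfolding retraction_map_def retraction_maps_def by (intro exI [of _ "\<lambda>_. a"]) auto
  from surj_hom_induced_retraction_map [OF this, of 0]
  have "?h \<in> iso (homology_group 0 X) (homology_group 0 ?pt)"
    using inj hom_induced_empty_hom by (simp add: iso_def bij_betw_def)
  then have "homology_group 0 X \<cong> homology_group 0 ?pt"
    by (rule is_isoI)
  from isomorphic_homology_imp_path_connectedness [OF this] show ?thesis
    by (simp add: path_connected_space_discrete_topology)
qed

lemma bubble_space_homology:
  assumes "bubble_space n N X" "Hausdorff_space X" "add_mset n N = mset_set D" "finite D"
  shows "homology_in_dims X D" "0 \<notin> D" "topspace X \<noteq> {}"
proof -
  obtain ps where ps: "bubble X ps" "fst (hd ps) = n" "mset (map fst (tl ps)) = N"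
    using assms(1) by (auto simp: bubble_space_def)
  note H = bubble_homology [OF ps(1) assms(2)]
  have "ps = hd ps # tl ps"
    using H by simp
  then have "mset (map fst ps) = mset (map fst (hd ps # tl ps))"
    by (rule arg_cong)
  also have "\<dots> = mset_set D"
    using ps(2,3) assms(3) by simp
  finally have eq: "mset (map fst ps) = mset_set D" .
  have set: "set (map fst ps) = D"
    using arg_cong [OF eq, of set_mset] assms(4) by (simp only: set_mset_mset finite_set_mset_mset_set)
  \<comment> \<open>The multiset of a finite set has multiplicities at most 1.\<close>
  have "distinct (map fst ps)"
    unfolding distinct_count_atmost_1 eq set using assms(4) by (simp add: count_mset_set')
  then show "homology_in_dims X D" "0 \<notin> D" "topspace X \<noteq> {}"
    using H unfolding set by simp_all
qed

text \<open>The permutation is expressed as an equality of multisets of nonzero eigenvalues; the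
  added 1 is the eigenvalue in degree 0.\<close>

theorem theorem2p1:
  fixes X :: "'a topology" and f :: "'a \<Rightarrow> 'a"
    and r :: nat and n :: "nat \<Rightarrow> nat"
    and K :: "'k::euclidean_space set set"
    and E Odd :: "nat set"
  assumes "1 \<le> r"
    and "strict_mono_on {1..r} n"
    and "bubble_space (n r) (image_mset n (mset_set {1..<r})) X"
    and "connected_space X"
    and "simplicial_complex K" and "X homeomorphic_space top_of_set (\<Union>K)"
    and "continuous_map X X f"
    and E: "E = {i \<in> {1..r}. even (n i)}"
    and Odd: "Odd = {i \<in> {1..r}. odd (n i)}"
  shows "(\<forall>m\<ge>1. lefschetz_number X (f ^^ m) = 0) \<longleftrightarrow>
    image_mset (\<lambda>i. hom_eigenvalue (n i) X f) (mset_set {i \<in> Odd. hom_eigenvalue (n i) X f \<noteq> 0}) =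
    add_mset 1
      (image_mset (\<lambda>i. hom_eigenvalue (n i) X f) (mset_set {i \<in> E. hom_eigenvalue (n i) X f \<noteq> 0}))"
proof -
  let ?N = "n ` {1..r}"
  \<comment> \<open>The union of a complex is a subspace of a Euclidean space.\<close>
  have "Hausdorff_space X"
    using homeomorphic_Hausdorff_space [OF assms(6)] Hausdorff_space_subtopology Hausdorff_space_euclidean
    by metis
  have inj: "inj_on n {1..r}"
    using assms(2) by (rule strict_mono_on_imp_inj_on)
  have "add_mset (n r) (image_mset n (mset_set {1..<r})) = image_mset n (mset_set (insert r {1..<r}))"
    by simp
  also have "insert r {1..<r} = {1..r}"
    using assms(1) by auto
  also have "image_mset n (mset_set {1..r}) = mset_set ?N"
    by (rule image_mset_mset_set [OF inj])
  finally have dims: "add_mset (n r) (image_mset n (mset_set {1..<r})) = mset_set ?N" .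
  have "finite ?N"
    by simp
  note H = bubble_space_homology [OF assms(3) \<open>Hausdorff_space X\<close> dims this]
  note hom = H(1) and N0 = H(2) and ne = H(3)
  have pc: "path_connected_space X"
    using hom N0 ne by (rule homology_in_dims_path_connected)
  have "lefschetz_number X (f ^^ m) = 1 + (\<Sum>i\<in>{1..r}. (-1) ^ n i * hom_eigenvalue (n i) X f ^ m)" for m
  proof -
    \<comment> \<open>Reduced and ordinary homology agree in nonzero degrees, and 0 is not among the
      dimensions.\<close>
    have "homology_group (int p) X \<cong> integer_group" if "p \<in> ?N" for p
    proof -
      have "int p \<noteq> 0"
        using that N0 by (metis of_nat_0_eq_iff)
      then show ?thesis
        using hom that unfolding homology_in_dims_def by (metis un_reduced_homology_group)
    qed
    moreover have "trivial_group (homology_group (int p) X)" if "p \<notin> ?N" "p \<noteq> 0" for p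
    proof -
      have "int p \<notin> int ` ?N" "int p \<noteq> 0"
        using that by (simp_all add: image_iff)
      then show ?thesis
        using hom unfolding homology_in_dims_def by (metis un_reduced_homology_group)
    qed
    ultimately have "lefschetz_number X (f ^^ m) = 1 + (\<Sum>p\<in>?N. (-1) ^ p * hom_eigenvalue p X f ^ m)"
      using Lefschetz_formula [OF assms(7) pc ne _ N0] by blast
    then show ?thesis
      unfolding sum.reindex [OF inj] o_def .
  qed
  then have "(\<forall>m\<ge>1. lefschetz_number X (f ^^ m) = 0) \<longleftrightarrow>
     (\<forall>m\<ge>1. 1 + (\<Sum>i\<in>{1..r}. (-1) ^ n i * hom_eigenvalue (n i) X f ^ m) = 0)"
    by (simp only:)
  then show ?thesis
    unfolding E Odd Lefschetz_numbers_vanish_iff [OF finite_atLeastAtMost] .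
qed

end
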